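(* Fix $\beta>0$. Let $f\in\mathscr{H}^2$ and suppose that $f$ has an analytic continuation (of finite order) to the right half-plane $\mathbb{C}_0$ such that $\mu_f(\sigma)\leq\beta$ for every $\sigma>0$. Then \[\sigma_{\mathrm{m}}(f)\leq\frac{\beta}{1+2\beta}.\]
   Context: Write $s=\sigma+it$ and, for real $\kappa$, $\mathbb{C}_\kappa=\{s=\sigma+it : \sigma>\kappa\}$. $\mathscr{H}^2$ is the Hilbert space of Dirichlet series $f(s)=\sum_{n\geq1}a_n n^{-s}$ with complex coefficients and $\|f\|_{\mathscr{H}^2}^2=\sum_{n\geq1}|a_n|^2<\infty$; such a series converges absolutely and is analytic in $\mathbb{C}_{1/2}$. An analytic continuation of a somewhere convergent Dirichlet series $f$ to $\mathbb{C}_\kappa$ is an analytic function on $\mathbb{C}_\kappa$ that agrees with the sum of the series wherever the series converges in $\mathbb{C}_\kappa$; it is again denoted $f$. An analytic function $f$ on $\mathbb{C}_\kappa$ is of finite order in $\mathbb{C}_\kappa$ if for every $\varepsilon>0$ there are constants $A,B$ such that $|f(\sigma+it)|\leq B(1+|t|)^A$ for all $\sigma\geq\kappa+\varepsilon$ and all real $t$. For such $f$ the Lindelöf order function is \[\mu_f(\sigma)=\limsup_{|t|\to\infty}\frac{\log|f(\sigma+it)|}{\log|t|},\qquad \sigma>\kappa.\] Statements about $\mu_f$ on $(\kappa,\infty)$ presuppose that $f$ is of finite order in $\mathbb{C}_\kappa$. For a somewhere convergent Dirichlet series $f(s)=\sum_{n\geq1}a_n n^{-s}$, $\sigma_{\mathrm{m}}(f)$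 denotes the infimum of those real $\kappa$ such that $f$ has an analytic continuation of finite order to $\mathbb{C}_\kappa$ and such that for every $\sigma>\kappa$ the mean value formula \[\lim_{T\to\infty}\frac{1}{2T}\int_{-T}^T|f(\sigma+it)|^2\,dt=\sum_{n=1}^\infty|a_n|^2n^{-2\sigma}\] holds, in the sense that both sides are finite and equal. *)

theory Defs
  imports "HOL-Analysis.Analysis"
begin

text \<open>
  A Dirichlet series is given by its coefficient sequence \<open>a :: nat \<Rightarrow> complex\<close>. The series
  starts at \<open>n = 1\<close>: all sums below use \<open>Suc n\<close>, so the value \<open>a 0\<close> is irrelevant.
  Convergence (\<open>summable\<close>, \<open>suminf\<close>) is the ordinary, possibly conditional, convergence of
  partial sums.
\<close>

definition right_half_plane :: "real \<Rightarrow> complex set" where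
  "right_half_plane \<kappa> = {s. \<kappa> < Re s}"

definition dirichlet_term :: "(nat \<Rightarrow> complex) \<Rightarrow> complex \<Rightarrow> nat \<Rightarrow> complex" where
  "dirichlet_term a s n = a (Suc n) * of_nat (Suc n) powr (- s)"

definition hardy_H2 :: "(nat \<Rightarrow> complex) set" where
  "hardy_H2 = {a. summable (\<lambda>n. (norm (a (Suc n)))\<^sup>2)}"

definition is_continuation :: "(nat \<Rightarrow> complex) \<Rightarrow> real \<Rightarrow> (complex \<Rightarrow> complex) \<Rightarrow> bool" where
  "is_continuation a \<kappa> F \<longleftrightarrow>
     F holomorphic_on right_half_plane \<kappa> \<and>
     (\<forall>s\<in>right_half_plane \<kappa>. summable (dirichlet_term a s) \<longrightarrow> F s = suminf (dirichlet_term a s))"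

definition finite_order :: "real \<Rightarrow> (complex \<Rightarrow> complex) \<Rightarrow> bool" where
  "finite_order \<kappa> F \<longleftrightarrow>
     (\<forall>\<epsilon>>0. \<exists>A B. \<forall>\<sigma> t. \<sigma> \<ge> \<kappa> + \<epsilon> \<longrightarrow> norm (F (Complex \<sigma> t)) \<le> B * (1 + \<bar>t\<bar>) powr A)"

text \<open>
  The logarithm with \<open>log 0 = -\<infinity>\<close>. The real function \<open>ln\<close> satisfies \<open>ln 0 = 0\<close>, which would
  distort the order function when \<open>F\<close> has zeros on a vertical line.
\<close>

definition log_extended :: "real \<Rightarrow> ereal" where
  "log_extended x = (if x = 0 then -\<infinity> else ereal (ln x))"

text \<open>On the reals, \<open>at_infinity\<close> is the filter of \<open>\<bar>t\<bar> \<rightarrow> \<infinity>\<close> (in both directions).\<close>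

definition lindelof_order :: "(complex \<Rightarrow> complex) \<Rightarrow> real \<Rightarrow> ereal" where
  "lindelof_order F \<sigma> =
     Limsup at_infinity (\<lambda>t::real. log_extended (norm (F (Complex \<sigma> t))) / ereal (ln \<bar>t\<bar>))"

definition mean_value_formula :: "(nat \<Rightarrow> complex) \<Rightarrow> (complex \<Rightarrow> complex) \<Rightarrow> real \<Rightarrow> bool" where
  "mean_value_formula a F \<sigma> \<longleftrightarrow>
     summable (\<lambda>n. (norm (a (Suc n)))\<^sup>2 * real (Suc n) powr (- 2 * \<sigma>)) \<and>
     ((\<lambda>T. 1 / (2 * T) * integral {-T..T} (\<lambda>t. (norm (F (Complex \<sigma> t)))\<^sup>2))
        \<longlongrightarrow> (\<Sum>n. (norm (a (Suc n)))\<^sup>2 * real (Suc n) powr (- 2 * \<sigma>))) at_top"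

text \<open>The infimum is extended real valued: it is \<open>-\<infinity>\<close> for Dirichlet polynomials, for instance.\<close>

definition sigma_m :: "(nat \<Rightarrow> complex) \<Rightarrow> ereal" where
  "sigma_m a = Inf {ereal \<kappa> | \<kappa>. \<exists>F. is_continuation a \<kappa> F \<and> finite_order \<kappa> F \<and>
                                  (\<forall>\<sigma>>\<kappa>. mean_value_formula a F \<sigma>)}"

end

theory Submission
  imports Defs "HOL-Complex_Analysis.Cauchy_Integral_Formula" "HOL-Real_Asymp.Real_Asymp"
begin

text \<open>
  The mean value formula is proved on every line \<open>Re s = \<sigma>\<close> with \<open>\<sigma> > \<beta> / (1 + 2 \<beta>)\<close>, by comparing \<open>F\<close> on
  the segment \<open>\<bar>t\<bar> \<le> T\<close> with a partial sum \<open>S\<close> of length \<open>N\<close>, a power of \<open>T\<close>.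

  For the partial sum, the diagonal of the mean square over \<open>\<bar>t\<bar> \<le> T\<close> gives the expected value. Up to
  logarithms, the off-diagonal terms contribute at most \<open>N powr (1 - 2 \<sigma>)\<close> if \<open>\<sigma> < 1 / 2\<close>, and a bounded
  amount otherwise, because the coefficients are square summable (\<open>mean_square_dirichlet_polynomial\<close>).
  So \<open>N\<close> may be taken larger than \<open>T\<close>, almost \<open>T powr (1 / (1 - 2 \<sigma>))\<close> in the first case.

  For the difference \<open>F - S\<close>, Cauchy's formula is applied around \<open>s\<close> with a smoothed Perron kernel
  \<open>X powr w * exp (w\<^sup>2) / w\<close>, where \<open>X\<close> is smaller than \<open>N\<close> by a small power of \<open>T\<close>, on a rectangle that
  extends by some \<open>\<delta> < \<sigma>\<close> to the left, so that it stays in \<open>Re s > 0\<close>, and far to the right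
  (\<open>dirichlet_polynomial_approximation\<close>). On the right edge \<open>F - S\<close> is a tail of an absolutely convergent
  series and is tiny. On the left edge \<open>F\<close> is bounded by \<open>T powr \<beta>\<close>, nearly, and the kernel by
  \<open>X powr (- \<delta>)\<close>, with \<open>\<delta>\<close> as close to \<open>\<sigma>\<close> as necessary. The left edge integral of \<open>S\<close> is a Dirichlet
  polynomial with the coefficients of \<open>S\<close> multiplied by numbers bounded by \<open>(n / X) powr \<delta>\<close> up to a
  logarithm of \<open>T\<close>, so its mean square tends to 0 by the same mean value inequality
  (\<open>mean_square_error_le\<close>).

  Hence \<open>F - S\<close> has mean square tending to 0 as soon as \<open>X powr \<sigma>\<close> exceeds \<open>T powr \<beta>\<close> by a power of \<open>T\<close>.
  This is compatible with \<open>X powr (1 - 2 \<sigma>)\<close> being smaller than \<open>T\<close> by a power precisely if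
  \<open>\<beta> (1 - 2 \<sigma>) < \<sigma>\<close> (\<open>exponents_exist\<close>), and that is the bound for \<open>\<sigma>\<close>.
\<close>

section \<open>Mean squares of Dirichlet polynomials\<close>

text \<open>
  This controls the off-diagonal terms of a mean square. From \<open>ln x \<ge> 1 - 1 / x\<close> one gets
  \<open>max m n / \<bar>m - n\<bar>\<close>, that is, \<open>1 + min m n / \<bar>m - n\<bar>\<close>; the geometric mean then replaces the
  minimum because it splits symmetrically between the two coefficients that belong to \<open>m\<close> and \<open>n\<close>.
\<close>

lemma inverse_log_gap_le:
  fixes m n :: nat
  assumes "0 < m" "0 < n" "m \<noteq> n"
  shows "1 / \<bar>ln (real m) - ln (real n)\<bar> \<le> 1 + sqrt (real m) * sqrt (real n) / \<bar>real m - real n\<bar>"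
proof -
  have *: "1 / (ln (real m) - ln (real n)) \<le> 1 + sqrt (real m) * sqrt (real n) / (real m - real n)"
    if "0 < n" "n < m" for m n :: nat
  proof -
    have "ln (real n / real m) \<le> real n / real m - 1"
      using that by (intro ln_le_minus_one) auto
    then have ln_ge: "(real m - real n) / real m \<le> ln (real m) - ln (real n)"
      using that by (simp add: ln_div diff_divide_distrib)
    then have "1 / (ln (real m) - ln (real n)) \<le> 1 / ((real m - real n) / real m)"
      using that by (intro divide_left_mono mult_pos_pos) auto
    also have "\<dots> = 1 + real n / (real m - real n)"
      using that by (simp add: field_simps)
    also have "1 + real n / (real m - real n) = 1 + sqrt (real n) * sqrt (real n) / (real m - real n)"
      by simp
    also have "\<dots> \<le> 1 + sqrt (real m) * sqrt (real n) / (real m - real n)"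
      using that by (intro add_left_mono divide_right_mono mult_right_mono) auto
    finally show ?thesis by simp
  qed
  show ?thesis
  proof (cases "n < m")
    case True
    then have "ln (real n) < ln (real m)" using assms by simp
    then show ?thesis using *[of n m] True assms by simp
  next
    case False
    then have "m < n" using assms by simp
    moreover from this have "ln (real m) < ln (real n)" using assms by simp
    ultimately show ?thesis using *[of m n] assms by (simp add: mult.commute)
  qed
qed

lemma norm_integral_cis_le:
  fixes \<theta> T :: real
  assumes "\<theta> \<noteq> 0" "0 \<le> T"
  shows "norm (integral {-T..T} (\<lambda>t. cis (\<theta> * t))) \<le> 2 / \<bar>\<theta>\<bar>"
proof -
  have "((\<lambda>t. cis (\<theta> * t)) has_integral
      (cis (\<theta> * T) / (\<i> * \<theta>) - cis (\<theta> * (-T)) / (\<i> * \<theta>))) {-T..T}"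
  proof (rule fundamental_theorem_of_calculus)
    fix t assume "t \<in> {-T..T}"
    have "((\<lambda>z. exp (\<i> * of_real \<theta> * z) / (\<i> * of_real \<theta>)) has_field_derivative
        exp (\<i> * of_real \<theta> * of_real t)) (at (of_real t))"
      using assms by (auto intro!: derivative_eq_intros)
    then have "((\<lambda>x. exp (\<i> * of_real \<theta> * of_real x) / (\<i> * of_real \<theta>)) has_vector_derivative
        exp (\<i> * of_real \<theta> * of_real t)) (at t within {-T..T})"
      by (rule has_vector_derivative_real_field)
    then show "((\<lambda>t. cis (\<theta> * t) / (\<i> * \<theta>)) has_vector_derivative cis (\<theta> * t)) (at t within {-T..T})"
      by (simp add: cis_conv_exp mult_ac)
  qed (use assms in auto)
  then have "integral {-T..T} (\<lambda>t. cis (\<theta> * t)) = cis (\<theta> * T) / (\<i> * \<theta>) - cis (\<theta> * (-T)) / (\<i> * \<theta>)"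
    by (rule integral_unique)
  also have "norm \<dots> \<le> norm (cis (\<theta> * T) / (\<i> * \<theta>)) + norm (cis (\<theta> * (-T)) / (\<i> * \<theta>))"
    by (rule norm_triangle_ineq4)
  also have "\<dots> = 2 / \<bar>\<theta>\<bar>"
    by (simp add: norm_divide norm_mult)
  finally show ?thesis .
qed

lemma sum_inverse_distance_le:
  fixes n N :: nat
  assumes "n \<in> {1..N}"
  shows "(\<Sum>m\<in>{1..N} - {n}. 1 / \<bar>real m - real n\<bar>) \<le> 2 * harm N"
proof -
  have split: "{1..N} - {n} = {1..<n} \<union> {n<..N}" using assms by auto
  have "(\<Sum>m\<in>{1..N} - {n}. 1 / \<bar>real m - real n\<bar>)
      = (\<Sum>m\<in>{1..<n}. 1 / \<bar>real m - real n\<bar>) + (\<Sum>m\<in>{n<..N}. 1 / \<bar>real m - real n\<bar>)"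
    unfolding split by (rule sum.union_disjoint) auto
  also have "(\<Sum>m\<in>{1..<n}. 1 / \<bar>real m - real n\<bar>) = (\<Sum>k\<in>{1..<n}. inverse (real k))"
    by (rule sum.reindex_bij_witness[of _ "\<lambda>k. n - k" "\<lambda>k. n - k"])
       (auto simp: of_nat_diff inverse_eq_divide)
  also have "\<dots> \<le> harm N"
    unfolding harm_def using assms by (intro sum_mono2) auto
  also have "(\<Sum>m\<in>{n<..N}. 1 / \<bar>real m - real n\<bar>) = (\<Sum>k\<in>{1..N-n}. inverse (real k))"
    by (rule sum.reindex_bij_witness[of _ "\<lambda>k. k + n" "\<lambda>k. k - n"])
       (auto simp: of_nat_diff inverse_eq_divide)
  also have "\<dots> \<le> harm N"
    unfolding harm_def using assms by (intro sum_mono2) auto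
  finally show ?thesis by simp
qed

text \<open>
  A Montgomery--Vaughan inequality with the elementary loss of a factor \<open>ln N\<close>. The error term is the
  contribution of the pairs \<open>m \<noteq> n\<close>, each of size \<open>\<bar>c m\<bar> \<bar>c n\<bar> / \<bar>ln m - ln n\<bar>\<close>. By
  \<open>inverse_log_gap_le\<close> this has a part \<open>\<bar>c m\<bar> \<bar>c n\<bar>\<close>, which Cauchy's inequality sums, and a part
  \<open>u m u n / \<bar>m - n\<bar>\<close> with \<open>u n = sqrt n \<bar>c n\<bar>\<close>, which \<open>2 u m u n \<le> (u m)\<^sup>2 + (u n)\<^sup>2\<close> reduces to a
  harmonic sum. The loss is harmless here, since all later estimates save a power of \<open>T\<close>.
\<close>

lemma mean_square_dirichlet_polynomial:
  fixes c :: "nat \<Rightarrow> complex" and N :: nat and T :: real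
  assumes "0 \<le> T"
  shows "\<bar>integral {-T..T} (\<lambda>t. (norm (\<Sum>n=1..N. c n * cis (- (t * ln (real n)))))\<^sup>2)
            - 2 * T * (\<Sum>n=1..N. (norm (c n))\<^sup>2)\<bar>
         \<le> 6 * harm N * (\<Sum>n=1..N. real n * (norm (c n))\<^sup>2)"
proof -
  define I where "I = {1..N}"
  define u where "u n = sqrt (real n) * norm (c n)" for n
  define W where "W = (\<Sum>n\<in>I. (u n)\<^sup>2)"
  define J where "J m n = integral {-T..T} (\<lambda>t. cis ((ln (real n) - ln (real m)) * t))" for m n :: nat
  have fin: "finite I" by (simp add: I_def)
  have square: "complex_of_real ((norm (\<Sum>n\<in>I. c n * cis (- (t * ln (real n)))))\<^sup>2)
     = (\<Sum>m\<in>I. \<Sum>n\<in>I. c m * cnj (c n) * cis ((ln (real n) - ln (real m)) * t))" for t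
  proof -
    have cis: "cis ((ln (real n) - ln (real m)) * t)
        = cis (- (t * ln (real m))) * cnj (cis (- (t * ln (real n))))" for m n :: nat
      by (simp add: cis_mult cis_cnj algebra_simps)
    show ?thesis
      by (simp only: complex_norm_square cnj_sum sum_product cis complex_cnj_mult)
         (simp add: mult_ac)
  qed
  have int: "(\<lambda>t. cis (\<theta> * t)) integrable_on {-T..T}" for \<theta>
    by (intro integrable_continuous_interval continuous_intros)
  have "((\<lambda>t. \<Sum>m\<in>I. \<Sum>n\<in>I. c m * cnj (c n) * cis ((ln (real n) - ln (real m)) * t)) has_integral
      (\<Sum>m\<in>I. \<Sum>n\<in>I. c m * cnj (c n) * J m n)) {-T..T}"
    unfolding J_def by (intro has_integral_sum fin has_integral_mult_right integrable_integral int)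
  then have "((\<lambda>t. complex_of_real ((norm (\<Sum>n\<in>I. c n * cis (- (t * ln (real n)))))\<^sup>2)) has_integral
      (\<Sum>m\<in>I. \<Sum>n\<in>I. c m * cnj (c n) * J m n)) {-T..T}"
    unfolding square .
  moreover have "((\<lambda>t. complex_of_real ((norm (\<Sum>n\<in>I. c n * cis (- (t * ln (real n)))))\<^sup>2)) has_integral
      complex_of_real (integral {-T..T} (\<lambda>t. (norm (\<Sum>n\<in>I. c n * cis (- (t * ln (real n)))))\<^sup>2))) {-T..T}"
    by (intro has_integral_of_real integrable_integral integrable_continuous_interval continuous_intros)
  ultimately have "complex_of_real (integral {-T..T} (\<lambda>t. (norm (\<Sum>n\<in>I. c n * cis (- (t * ln (real n)))))\<^sup>2))
      = (\<Sum>m\<in>I. \<Sum>n\<in>I. c m * cnj (c n) * J m n)"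
    using has_integral_unique by blast
  also have "\<dots> = (\<Sum>m\<in>I. c m * cnj (c m) * J m m + (\<Sum>n\<in>I - {m}. c m * cnj (c n) * J m n))"
    using fin by (intro sum.cong refl sum.remove) auto
  also have "\<dots> = of_real (2 * T * (\<Sum>n\<in>I. (norm (c n))\<^sup>2)) + (\<Sum>m\<in>I. \<Sum>n\<in>I - {m}. c m * cnj (c n) * J m n)"
  proof -
    have "c m * cnj (c m) * J m m = of_real (2 * T * (norm (c m))\<^sup>2)" for m
      using assms by (simp add: J_def complex_norm_square[symmetric] scaleR_conv_of_real)
    then show ?thesis by (simp add: sum.distrib sum_distrib_left)
  qed
  finally have eq: "complex_of_real (integral {-T..T} (\<lambda>t. (norm (\<Sum>n\<in>I. c n * cis (- (t * ln (real n)))))\<^sup>2)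
      - 2 * T * (\<Sum>n\<in>I. (norm (c n))\<^sup>2)) = (\<Sum>m\<in>I. \<Sum>n\<in>I - {m}. c m * cnj (c n) * J m n)"
    by simp
  have term_le: "norm (c m * cnj (c n) * J m n)
      \<le> 2 * (norm (c m) * norm (c n)) + ((u m)\<^sup>2 + (u n)\<^sup>2) / \<bar>real n - real m\<bar>"
    if "m \<in> I" "n \<in> I - {m}" for m n
  proof -
    have pos: "0 < m" "0 < n" "n \<noteq> m" using that by (auto simp: I_def)
    then have "norm (J m n) \<le> 2 * (1 / \<bar>ln (real n) - ln (real m)\<bar>)"
      unfolding J_def using assms norm_integral_cis_le[of "ln (real n) - ln (real m)" T] by simp
    also have "\<dots> \<le> 2 * (1 + sqrt (real n) * sqrt (real m) / \<bar>real n - real m\<bar>)"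
      using pos by (intro mult_left_mono inverse_log_gap_le) auto
    finally have "norm (c m * cnj (c n) * J m n)
        \<le> norm (c m) * norm (c n) * (2 * (1 + sqrt (real n) * sqrt (real m) / \<bar>real n - real m\<bar>))"
      by (simp add: norm_mult mult_left_mono)
    also have "\<dots> = 2 * (norm (c m) * norm (c n)) + 2 * u m * u n / \<bar>real n - real m\<bar>"
      by (simp add: u_def algebra_simps)
    also have "\<dots> \<le> 2 * (norm (c m) * norm (c n)) + ((u m)\<^sup>2 + (u n)\<^sup>2) / \<bar>real n - real m\<bar>"
      by (intro add_left_mono divide_right_mono sum_squares_bound) auto
    finally show ?thesis .
  qed
  have far: "(\<Sum>m\<in>I. \<Sum>n\<in>I - {m}. norm (c m) * norm (c n)) \<le> harm N * W"
  proof -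
    have "(\<Sum>m\<in>I. \<Sum>n\<in>I - {m}. norm (c m) * norm (c n)) \<le> (\<Sum>m\<in>I. \<Sum>n\<in>I. norm (c m) * norm (c n))"
      using fin by (intro sum_mono sum_mono2) auto
    also have "\<dots> = (\<Sum>n\<in>I. norm (c n))\<^sup>2"
      by (simp add: power2_eq_square sum_product)
    also have "(\<Sum>n\<in>I. norm (c n)) = (\<Sum>n\<in>I. (1 / sqrt (real n)) * u n)"
      by (intro sum.cong refl) (auto simp: u_def I_def)
    also have "\<dots>\<^sup>2 \<le> (\<Sum>n\<in>I. (1 / sqrt (real n))\<^sup>2) * (\<Sum>n\<in>I. (u n)\<^sup>2)"
      by (rule Cauchy_Schwarz_ineq_sum)
    also have "(\<Sum>n\<in>I. (1 / sqrt (real n))\<^sup>2) = harm N"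
      by (simp add: harm_def I_def power_divide inverse_eq_divide)
    finally show ?thesis by (simp add: W_def)
  qed
  have near: "(\<Sum>m\<in>I. \<Sum>n\<in>I - {m}. (u m)\<^sup>2 / \<bar>real n - real m\<bar>) \<le> 2 * harm N * W"
  proof -
    have "(\<Sum>m\<in>I. \<Sum>n\<in>I - {m}. (u m)\<^sup>2 / \<bar>real n - real m\<bar>)
        = (\<Sum>m\<in>I. (u m)\<^sup>2 * (\<Sum>n\<in>I - {m}. 1 / \<bar>real n - real m\<bar>))"
      by (simp add: sum_distrib_left)
    also have "\<dots> \<le> (\<Sum>m\<in>I. (u m)\<^sup>2 * (2 * harm N))"
      unfolding I_def by (intro sum_mono mult_left_mono sum_inverse_distance_le) auto
    finally show ?thesis by (simp add: W_def sum_distrib_right sum_distrib_left mult_ac)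
  qed
  have swap: "(\<Sum>m\<in>I. \<Sum>n\<in>I - {m}. (u n)\<^sup>2 / \<bar>real n - real m\<bar>)
      = (\<Sum>m\<in>I. \<Sum>n\<in>I - {m}. (u m)\<^sup>2 / \<bar>real n - real m\<bar>)"
  proof -
    have "(\<Sum>m\<in>I. \<Sum>n\<in>I - {m}. h m n) = (\<Sum>m\<in>I. \<Sum>n\<in>I - {m}. h n m)" for h :: "nat \<Rightarrow> nat \<Rightarrow> real"
      unfolding sum.Sigma[OF fin ballI[OF finite_Diff[OF fin]]]
      by (rule sum.reindex_bij_witness[of _ prod.swap prod.swap]) auto
    from this[of "\<lambda>m n. (u n)\<^sup>2 / \<bar>real n - real m\<bar>"] show ?thesis
      by (simp add: abs_minus_commute)
  qed
  have "norm (\<Sum>m\<in>I. \<Sum>n\<in>I - {m}. c m * cnj (c n) * J m n)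
      \<le> (\<Sum>m\<in>I. \<Sum>n\<in>I - {m}. 2 * (norm (c m) * norm (c n)) + ((u m)\<^sup>2 + (u n)\<^sup>2) / \<bar>real n - real m\<bar>)"
    by (intro sum_norm_le term_le)
  also have "\<dots> = 2 * (\<Sum>m\<in>I. \<Sum>n\<in>I - {m}. norm (c m) * norm (c n))
      + (\<Sum>m\<in>I. \<Sum>n\<in>I - {m}. (u m)\<^sup>2 / \<bar>real n - real m\<bar>)
      + (\<Sum>m\<in>I. \<Sum>n\<in>I - {m}. (u n)\<^sup>2 / \<bar>real n - real m\<bar>)"
    by (simp add: sum.distrib add_divide_distrib sum_distrib_left)
  also have "\<dots> \<le> 6 * harm N * W"
    using far near swap by simp
  finally have "norm (complex_of_real (integral {-T..T} (\<lambda>t. (norm (\<Sum>n\<in>I. c n * cis (- (t * ln (real n)))))\<^sup>2)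
      - 2 * T * (\<Sum>n\<in>I. (norm (c n))\<^sup>2))) \<le> 6 * harm N * W"
    unfolding eq .
  moreover have "W = (\<Sum>n\<in>I. real n * (norm (c n))\<^sup>2)"
    by (simp add: W_def u_def power_mult_distrib)
  ultimately show ?thesis
    unfolding norm_of_real I_def by simp
qed

section \<open>A smoothed Cauchy formula on rectangles\<close>

text \<open>
  With \<open>L = ln X\<close> this is the Perron kernel \<open>X powr w / w\<close> times the Gaussian factor \<open>exp (w\<^sup>2)\<close>, which
  has the value 1 at the pole and makes the horizontal edges of a rectangle negligible against any
  polynomial growth.
\<close>

definition smoothing_kernel :: "real \<Rightarrow> complex \<Rightarrow> complex" where
  "smoothing_kernel L w = exp (of_real L * w + w\<^sup>2) / w"

lemma norm_smoothing_kernel: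
  "norm (smoothing_kernel L w) = exp (L * Re w + (Re w)\<^sup>2 - (Im w)\<^sup>2) / norm w"
  by (simp add: smoothing_kernel_def norm_divide power2_eq_square)

lemma continuous_on_smoothing_kernel:
  "0 \<notin> A \<Longrightarrow> continuous_on A (smoothing_kernel L)"
  unfolding smoothing_kernel_def by (intro continuous_intros) auto

text \<open>
  Supremum times length is precise enough, because the edges will have length \<open>O(ln T)\<close>.
\<close>

lemma norm_edge_integral_le:
  assumes "continuous_on (closed_segment u v) f" "0 \<notin> closed_segment u v"
    and "0 \<le> B" "0 < r" "norm (v - u) \<le> l"
    and "\<And>w. w \<in> closed_segment u v \<Longrightarrow>
           norm (f w) \<le> B \<and> L * Re w + (Re w)\<^sup>2 - (Im w)\<^sup>2 \<le> E \<and> r \<le> norm w"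
  shows "norm (contour_integral (linepath u v) (\<lambda>w. f w * smoothing_kernel L w)) \<le> B * (exp E / r) * l"
proof -
  have "norm (contour_integral (linepath u v) (\<lambda>w. f w * smoothing_kernel L w)) \<le> B * (exp E / r) * norm (v - u)"
  proof (rule contour_integral_bound_linepath)
    show "(\<lambda>w. f w * smoothing_kernel L w) contour_integrable_on linepath u v"
      using assms
      by (intro contour_integrable_continuous_linepath continuous_intros continuous_on_smoothing_kernel) auto
  next
    fix w assume "w \<in> closed_segment u v"
    from assms(6)[OF this]
    have w: "norm (f w) \<le> B" "L * Re w + (Re w)\<^sup>2 - (Im w)\<^sup>2 \<le> E" "r \<le> norm w"
      by blast+
    have "norm (smoothing_kernel L w) \<le> exp E / r"
      unfolding norm_smoothing_kernel using w \<open>0 < r\<close> by (intro frac_le) auto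
    then show "norm (f w * smoothing_kernel L w) \<le> B * (exp E / r)"
      unfolding norm_mult using w \<open>0 \<le> B\<close> by (intro mult_mono) auto
  qed (use assms in auto)
  also have "\<dots> \<le> B * (exp E / r) * l"
    using assms by (intro mult_left_mono) auto
  finally show ?thesis .
qed

lemma closed_segment_horizontal:
  "w \<in> closed_segment (Complex x y) (Complex x' y) \<Longrightarrow> Im w = y \<and> Re w \<in> closed_segment x x'"
  by (auto simp: closed_segment_same_Im)

lemma closed_segment_vertical:
  "w \<in> closed_segment (Complex x y) (Complex x y') \<Longrightarrow> Re w = x \<and> Im w \<in> closed_segment y y'"
  by (auto simp: closed_segment_same_Re)

text \<open>
  Cauchy's formula for \<open>f - p\<close> and the kernel on the rectangle with vertical edges at \<open>-\<delta>\<close> and \<open>c\<close>.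
  On the right edge the difference \<open>f - p\<close> is small, and on the horizontal edges the kernel is, so there
  \<open>f - p\<close> is estimated as a whole.
  On the left edge the two functions are separated: \<open>f\<close> is estimated pointwise, whereas the integral of
  \<open>p\<close> is kept exactly. It is again a Dirichlet polynomial if \<open>p\<close> is one, so that its mean square can be
  used instead of its much larger supremum.
\<close>

lemma smoothed_cauchy_approximation:
  fixes f p :: "complex \<Rightarrow> complex"
  assumes f: "f holomorphic_on {w. -\<sigma> < Re w}" and p: "p holomorphic_on {w. -\<sigma> < Re w}"
    and pos: "0 < \<delta>" "\<delta> < \<sigma>" "\<delta> \<le> c" "0 < R" "0 \<le> L"
    and hor: "\<And>w. -\<delta> \<le> Re w \<Longrightarrow> \<bar>Im w\<bar> \<le> R \<Longrightarrow> norm (f w - p w) \<le> H"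
    and right: "\<And>w. Re w = c \<Longrightarrow> norm (f w - p w) \<le> G"
    and left: "\<And>w. Re w = -\<delta> \<Longrightarrow> \<bar>Im w\<bar> \<le> R \<Longrightarrow> norm (f w) \<le> M"
  shows "norm (f 0 - p 0 + contour_integral (linepath (Complex (-\<delta>) R) (Complex (-\<delta>) (-R)))
                              (\<lambda>w. p w * smoothing_kernel L w) / (2 * pi * \<i>))
         \<le> 2 * (H * (exp (L * c + c\<^sup>2 - R\<^sup>2) / R) * (2 * c))
            + G * (exp (L * c + c\<^sup>2) / c) * (2 * R)
            + M * (exp (\<delta>\<^sup>2 - L * \<delta>) / \<delta>) * (2 * R)"
proof -
  define D where "D = {w. -\<sigma> < Re w}"
  define q where "q w = f w - p w" for w
  define K where "K = smoothing_kernel L"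
  define a1 where "a1 = Complex (-\<delta>) (-R)"
  define a2 where "a2 = Complex c (-R)"
  define a3 where "a3 = Complex c R"
  define a4 where "a4 = Complex (-\<delta>) R"
  have openD: "open D" and convD: "convex D"
    unfolding D_def by (auto simp: open_halfspace_Re_gt convex_halfspace_Re_gt)
  have holq: "q holomorphic_on D"
    unfolding q_def D_def using f p by (intro holomorphic_intros)
  have seg: "closed_segment a1 a2 \<subseteq> D - {0}" "closed_segment a2 a3 \<subseteq> D - {0}"
            "closed_segment a3 a4 \<subseteq> D - {0}" "closed_segment a4 a1 \<subseteq> D - {0}"
    using pos unfolding a1_def a2_def a3_def a4_def D_def
    by (auto dest!: closed_segment_horizontal closed_segment_vertical
        simp: closed_segment_eq_real_ivl split: if_splits)
  have cont: "continuous_on D f" "continuous_on D p" "continuous_on D q"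
    using f p holq unfolding D_def by (auto intro: holomorphic_on_imp_continuous_on)
  have integrable: "(\<lambda>w. h w * K w) contour_integrable_on linepath u v"
    if "continuous_on D h" "closed_segment u v \<subseteq> D - {0}" for h u v
    unfolding K_def using that
    by (intro contour_integrable_continuous_linepath continuous_intros continuous_on_smoothing_kernel)
       (auto elim: continuous_on_subset)
  have rect: "rectpath a1 a3 = linepath a1 a2 +++ linepath a2 a3 +++ linepath a3 a4 +++ linepath a4 a1"
    by (simp add: rectpath_def Let_def a1_def a2_def a3_def a4_def)
  have "((\<lambda>w. q w * exp (of_real L * w + w\<^sup>2) / (w - 0)) has_contour_integral
      (2 * pi * \<i> * winding_number (rectpath a1 a3) 0 * (q 0 * exp (of_real L * 0 + 0\<^sup>2)))) (rectpath a1 a3)"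
  proof (rule Cauchy_integral_formula_convex_simple[OF convD])
    show "(\<lambda>w. q w * exp (of_real L * w + w\<^sup>2)) holomorphic_on D"
      by (intro holomorphic_intros holq)
    show "0 \<in> interior D"
      using pos openD by (simp add: interior_open D_def)
    show "path_image (rectpath a1 a3) \<subseteq> D - {0}"
      unfolding rect using seg by (auto simp: path_image_join)
  qed auto
  moreover have "winding_number (rectpath a1 a3) 0 = 1"
    using pos by (intro winding_number_rectpath) (auto simp: a1_def a3_def in_box_complex_iff)
  ultimately have "((\<lambda>w. q w * K w) has_contour_integral 2 * pi * \<i> * q 0) (rectpath a1 a3)"
    by (simp add: K_def smoothing_kernel_def)
  then have "2 * pi * \<i> * q 0 = contour_integral (rectpath a1 a3) (\<lambda>w. q w * K w)"
    by (simp add: contour_integral_unique)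
  also have "\<dots> = contour_integral (linepath a1 a2) (\<lambda>w. q w * K w)
      + contour_integral (linepath a2 a3) (\<lambda>w. q w * K w)
      + contour_integral (linepath a3 a4) (\<lambda>w. q w * K w)
      + contour_integral (linepath a4 a1) (\<lambda>w. q w * K w)"
    unfolding rect using seg cont by (simp add: integrable)
  also have "contour_integral (linepath a4 a1) (\<lambda>w. q w * K w)
      = contour_integral (linepath a4 a1) (\<lambda>w. f w * K w) - contour_integral (linepath a4 a1) (\<lambda>w. p w * K w)"
    unfolding q_def left_diff_distrib using seg cont by (intro contour_integral_diff integrable)
  finally have main: "2 * pi * \<i> * q 0 + contour_integral (linepath a4 a1) (\<lambda>w. p w * K w)
      = contour_integral (linepath a1 a2) (\<lambda>w. q w * K w)
      + contour_integral (linepath a2 a3) (\<lambda>w. q w * K w)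
      + contour_integral (linepath a3 a4) (\<lambda>w. q w * K w)
      + contour_integral (linepath a4 a1) (\<lambda>w. f w * K w)" (is "_ = ?b + ?r + ?t + ?l")
    by (simp add: algebra_simps)
  have nonneg: "0 \<le> H" "0 \<le> G" "0 \<le> M"
    using order_trans[OF norm_ge_zero hor[of 0]] order_trans[OF norm_ge_zero right[of "of_real c"]]
      order_trans[OF norm_ge_zero left[of "of_real (-\<delta>)"]] pos by auto
  have horE: "L * x + x\<^sup>2 \<le> L * c + c\<^sup>2" if "-\<delta> \<le> x" "x \<le> c" for x
  proof -
    have "\<bar>x\<bar> \<le> \<bar>c\<bar>" using that pos by auto
    then have "x\<^sup>2 \<le> c\<^sup>2" by (simp add: abs_le_square_iff)
    moreover have "L * x \<le> L * c" using that pos by (intro mult_left_mono) auto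
    ultimately show ?thesis by simp
  qed
  have ImR: "\<bar>y\<bar> \<le> norm w" if "\<bar>Im w\<bar> = \<bar>y\<bar>" for w y
    using abs_Im_le_cmod[of w] that by simp
  have ReR: "\<bar>x\<bar> \<le> norm w" if "\<bar>Re w\<bar> = \<bar>x\<bar>" for w x
    using abs_Re_le_cmod[of w] that by simp
  have bq: "norm (f w - p w) \<le> H" if "w \<in> closed_segment a1 a2 \<union> closed_segment a3 a4" for w
    using that pos unfolding a1_def a2_def a3_def a4_def
    by (intro hor) (auto dest!: closed_segment_horizontal simp: closed_segment_eq_real_ivl split: if_splits)
  have b: "norm ?b \<le> H * (exp (L * c + c\<^sup>2 - R\<^sup>2) / R) * (2 * c)"
    unfolding K_def
  proof (rule norm_edge_integral_le)
    show "norm (a2 - a1) \<le> 2 * c"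
      using pos cmod_le[of "a2 - a1"] by (simp add: a1_def a2_def a3_def a4_def)
    show "norm (q w) \<le> H \<and> L * Re w + (Re w)\<^sup>2 - (Im w)\<^sup>2 \<le> L * c + c\<^sup>2 - R\<^sup>2 \<and> R \<le> norm w"
      if "w \<in> closed_segment a1 a2" for w
      using that pos bq[of w] horE[of "Re w"] ImR[of w R] unfolding a1_def a2_def q_def
      by (auto dest!: closed_segment_horizontal simp: closed_segment_eq_real_ivl split: if_splits)
  qed (use seg cont nonneg pos in \<open>auto elim: continuous_on_subset\<close>)
  have t: "norm ?t \<le> H * (exp (L * c + c\<^sup>2 - R\<^sup>2) / R) * (2 * c)"
    unfolding K_def
  proof (rule norm_edge_integral_le)
    show "norm (a4 - a3) \<le> 2 * c"
      using pos cmod_le[of "a4 - a3"] by (simp add: a1_def a2_def a3_def a4_def)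
    show "norm (q w) \<le> H \<and> L * Re w + (Re w)\<^sup>2 - (Im w)\<^sup>2 \<le> L * c + c\<^sup>2 - R\<^sup>2 \<and> R \<le> norm w"
      if "w \<in> closed_segment a3 a4" for w
      using that pos bq[of w] horE[of "Re w"] ImR[of w R] unfolding a3_def a4_def q_def
      by (auto dest!: closed_segment_horizontal simp: closed_segment_eq_real_ivl split: if_splits)
  qed (use seg cont nonneg pos in \<open>auto elim: continuous_on_subset\<close>)
  have r: "norm ?r \<le> G * (exp (L * c + c\<^sup>2) / c) * (2 * R)"
    unfolding K_def
  proof (rule norm_edge_integral_le)
    show "norm (a3 - a2) \<le> 2 * R"
      using pos cmod_le[of "a3 - a2"] by (simp add: a1_def a2_def a3_def a4_def)
    show "norm (q w) \<le> G \<and> L * Re w + (Re w)\<^sup>2 - (Im w)\<^sup>2 \<le> L * c + c\<^sup>2 \<and> c \<le> norm w"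
      if "w \<in> closed_segment a2 a3" for w
      using that pos right[of w] ReR[of w c] unfolding a2_def a3_def q_def
      by (auto dest!: closed_segment_vertical)
  qed (use seg cont nonneg pos in \<open>auto elim: continuous_on_subset\<close>)
  have l: "norm ?l \<le> M * (exp (\<delta>\<^sup>2 - L * \<delta>) / \<delta>) * (2 * R)"
    unfolding K_def
  proof (rule norm_edge_integral_le)
    show "norm (a1 - a4) \<le> 2 * R"
      using pos cmod_le[of "a1 - a4"] by (simp add: a1_def a2_def a3_def a4_def)
    show "norm (f w) \<le> M \<and> L * Re w + (Re w)\<^sup>2 - (Im w)\<^sup>2 \<le> \<delta>\<^sup>2 - L * \<delta> \<and> \<delta> \<le> norm w"
      if "w \<in> closed_segment a4 a1" for w
      using that pos left[of w] ReR[of w \<delta>] unfolding a1_def a4_def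
      by (auto dest!: closed_segment_vertical simp: closed_segment_eq_real_ivl split: if_splits)
  qed (use seg cont nonneg pos in \<open>auto elim: continuous_on_subset\<close>)
  have "q 0 + contour_integral (linepath a4 a1) (\<lambda>w. p w * K w) / (2 * pi * \<i>)
      = (2 * pi * \<i> * q 0 + contour_integral (linepath a4 a1) (\<lambda>w. p w * K w)) / (2 * pi * \<i>)"
    by (simp add: field_simps)
  then have "norm (q 0 + contour_integral (linepath a4 a1) (\<lambda>w. p w * K w) / (2 * pi * \<i>))
      = norm (?b + ?r + ?t + ?l) / (2 * pi)"
    unfolding main by (simp add: norm_divide norm_mult)
  also have "\<dots> \<le> norm (?b + ?r + ?t + ?l) / 1"
    using pi_gt3 by (intro divide_left_mono) auto
  also have "\<dots> \<le> norm ?b + norm ?r + norm ?t + norm ?l"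
    by (simp add: norm_triangle_mono norm_triangle_le)
  also have "\<dots> \<le> H * (exp (L * c + c\<^sup>2 - R\<^sup>2) / R) * (2 * c) + G * (exp (L * c + c\<^sup>2) / c) * (2 * R)
      + H * (exp (L * c + c\<^sup>2 - R\<^sup>2) / R) * (2 * c) + M * (exp (\<delta>\<^sup>2 - L * \<delta>) / \<delta>) * (2 * R)"
    by (intro add_mono b r t l)
  finally show ?thesis
    by (simp add: q_def a1_def a4_def K_def mult_ac)
qed

section \<open>Approximation by Dirichlet polynomials on vertical segments\<close>

definition dirichlet_partial :: "(nat \<Rightarrow> complex) \<Rightarrow> nat \<Rightarrow> complex \<Rightarrow> complex" where
  "dirichlet_partial a N z = (\<Sum>n=1..N. a n * of_nat n powr (- z))"

lemma dirichlet_partial_eq_sum_terms: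
  "dirichlet_partial a N z = (\<Sum>n<N. dirichlet_term a z n)"
  by (simp add: dirichlet_partial_def dirichlet_term_def sum.atLeast1_atMost_eq)

lemma norm_of_nat_powr_minus:
  "0 < n \<Longrightarrow> norm ((of_nat n :: complex) powr (- z)) = real n powr (- Re z)"
  by (simp add: norm_powr_real_powr)

lemma of_nat_powr_minus_vertical:
  assumes "0 < n"
  shows "(of_nat n :: complex) powr (- (Complex \<sigma> t + w))
    = of_real (real n powr (- \<sigma>)) * cis (- (t * ln (real n))) * exp (- w * ln (real n))"
proof -
  have "(of_nat n :: complex) powr (- (Complex \<sigma> t + w)) = exp (- (Complex \<sigma> t + w) * of_real (ln (real n)))"
    using assms by (simp add: powr_def Ln_of_nat)
  also have "- (Complex \<sigma> t + w) * of_real (ln (real n))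
      = of_real (- \<sigma> * ln (real n)) + \<i> * of_real (- (t * ln (real n))) + (- w * of_real (ln (real n)))"
    by (simp add: complex_eq_iff algebra_simps)
  also have "exp \<dots> = of_real (exp (- \<sigma> * ln (real n))) * cis (- (t * ln (real n))) * exp (- w * ln (real n))"
    by (simp only: exp_add cis_conv_exp exp_of_real)
  also have "exp (- \<sigma> * ln (real n)) = real n powr (- \<sigma>)"
    using assms by (simp add: powr_def)
  finally show ?thesis by simp
qed

lemma dirichlet_partial_vertical:
  "dirichlet_partial a N (Complex \<sigma> t)
    = (\<Sum>n=1..N. (a n * of_real (real n powr (- \<sigma>))) * cis (- (t * ln (real n))))"
  unfolding dirichlet_partial_def
  using of_nat_powr_minus_vertical[where w = 0]
  by (intro sum.cong refl) (simp add: mult_ac)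

text \<open>
  The case of a Dirichlet series and its partial sum, translated to the point \<open>\<sigma> + i t\<close>. Since
  \<open>n powr (- s - w)\<close> factors, the left edge contributes a Dirichlet polynomial in \<open>t\<close> whose multipliers
  \<open>\<phi> n\<close> are the integrals of \<open>n powr (- w)\<close> against the kernel. They do not depend on \<open>t\<close>, which is what
  makes a mean value theorem applicable to this polynomial, and they are of size \<open>(n / X) powr \<delta>\<close>, with
  \<open>X = exp L\<close>, up to the length of the edge.
\<close>

lemma dirichlet_polynomial_approximation:
  fixes F :: "complex \<Rightarrow> complex" and a :: "nat \<Rightarrow> complex"
  assumes F: "F holomorphic_on right_half_plane 0"
    and pos: "0 < \<delta>" "\<delta> < \<sigma>" "\<delta> \<le> c" "0 < R" "0 \<le> L"
    and hor: "\<And>z. \<sigma> - \<delta> \<le> Re z \<Longrightarrow> \<bar>Im z\<bar> \<le> T + R \<Longrightarrow> norm (F z - dirichlet_partial a N z) \<le> H"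
    and right: "\<And>z. Re z = \<sigma> + c \<Longrightarrow> norm (F z - dirichlet_partial a N z) \<le> G"
    and left: "\<And>z. Re z = \<sigma> - \<delta> \<Longrightarrow> \<bar>Im z\<bar> \<le> T + R \<Longrightarrow> norm (F z) \<le> M"
  shows "\<exists>\<phi> :: nat \<Rightarrow> complex.
    (\<forall>n\<in>{1..N}. norm (\<phi> n) \<le> real n powr \<delta> * (exp (\<delta>\<^sup>2 - L * \<delta>) / \<delta> * (2 * R))) \<and>
    (\<forall>t. \<bar>t\<bar> \<le> T \<longrightarrow>
       norm (F (Complex \<sigma> t) - dirichlet_partial a N (Complex \<sigma> t)
             + (\<Sum>n=1..N. a n * of_real (real n powr (- \<sigma>)) * \<phi> n * cis (- (t * ln (real n)))))
       \<le> 2 * (H * (exp (L * c + c\<^sup>2 - R\<^sup>2) / R) * (2 * c))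
            + G * (exp (L * c + c\<^sup>2) / c) * (2 * R)
            + M * (exp (\<delta>\<^sup>2 - L * \<delta>) / \<delta>) * (2 * R))"
proof -
  define u where "u = Complex (-\<delta>) R"
  define v where "v = Complex (-\<delta>) (-R)"
  define I where "I n = contour_integral (linepath u v) (\<lambda>w. exp (- w * ln (real n)) * smoothing_kernel L w)"
    for n :: nat
  define \<phi> where "\<phi> n = I n / (2 * pi * \<i>)" for n
  have no0: "0 \<notin> closed_segment u v"
    using pos unfolding u_def v_def by (auto dest!: closed_segment_vertical)
  have bound: "norm (\<phi> n) \<le> real n powr \<delta> * (exp (\<delta>\<^sup>2 - L * \<delta>) / \<delta> * (2 * R))" if "n \<in> {1..N}" for n
  proof -
    have "norm (I n) \<le> real n powr \<delta> * (exp (\<delta>\<^sup>2 - L * \<delta>) / \<delta>) * (2 * R)"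
      unfolding I_def
    proof (rule norm_edge_integral_le[OF _ no0])
      show "norm (v - u) \<le> 2 * R"
        using pos cmod_le[of "v - u"] by (simp add: u_def v_def)
      show "norm (exp (- w * ln (real n))) \<le> real n powr \<delta> \<and> L * Re w + (Re w)\<^sup>2 - (Im w)\<^sup>2 \<le> \<delta>\<^sup>2 - L * \<delta> \<and> \<delta> \<le> norm w"
        if "w \<in> closed_segment u v" for w
      proof -
        have "Re w = - \<delta>" using that unfolding u_def v_def by (auto dest!: closed_segment_vertical)
        then show ?thesis
          using abs_Re_le_cmod[of w] pos \<open>n \<in> {1..N}\<close> by (simp add: powr_def)
      qed
    qed (use pos in \<open>auto intro!: continuous_intros\<close>)
    moreover have "norm (\<phi> n) \<le> norm (I n) / 1"
      unfolding \<phi>_def norm_divide using pi_gt3 by (intro divide_left_mono) (auto simp: norm_mult)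
    ultimately show ?thesis by (simp add: mult_ac)
  qed
  have approx: "norm (F (Complex \<sigma> t) - dirichlet_partial a N (Complex \<sigma> t)
             + (\<Sum>n=1..N. a n * of_real (real n powr (- \<sigma>)) * \<phi> n * cis (- (t * ln (real n)))))
       \<le> 2 * (H * (exp (L * c + c\<^sup>2 - R\<^sup>2) / R) * (2 * c))
            + G * (exp (L * c + c\<^sup>2) / c) * (2 * R)
            + M * (exp (\<delta>\<^sup>2 - L * \<delta>) / \<delta>) * (2 * R)"
    if t: "\<bar>t\<bar> \<le> T" for t
  proof -
    define s where "s = Complex \<sigma> t"
    define p where "p w = dirichlet_partial a N (s + w)" for w
    define b where "b n = a n * of_real (real n powr (- \<sigma>)) * cis (- (t * ln (real n)))" for n
    have p_eq: "p w = (\<Sum>n=1..N. b n * exp (- w * ln (real n)))" for w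
      unfolding p_def dirichlet_partial_def s_def b_def
    proof (intro sum.cong refl)
      fix n assume "n \<in> {1..N}"
      then show "a n * of_nat n powr (- (Complex \<sigma> t + w))
          = a n * of_real (real n powr (- \<sigma>)) * cis (- (t * ln (real n))) * exp (- w * ln (real n))"
        by (subst of_nat_powr_minus_vertical) (auto simp: mult_ac)
    qed
    have "contour_integral (linepath u v) (\<lambda>w. p w * smoothing_kernel L w)
        = contour_integral (linepath u v) (\<lambda>w. \<Sum>n=1..N. b n * (exp (- w * ln (real n)) * smoothing_kernel L w))"
      unfolding p_eq by (simp add: sum_distrib_left sum_distrib_right mult_ac)
    also have "\<dots> = (\<Sum>n=1..N. contour_integral (linepath u v)
                         (\<lambda>w. b n * (exp (- w * ln (real n)) * smoothing_kernel L w)))"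
      by (intro contour_integral_sum contour_integrable_continuous_linepath continuous_intros
            continuous_on_smoothing_kernel no0) auto
    also have "\<dots> = (\<Sum>n=1..N. b n * I n)"
      unfolding I_def
      by (intro sum.cong refl contour_integral_lmul contour_integrable_continuous_linepath continuous_intros
            continuous_on_smoothing_kernel no0)
    finally have int: "contour_integral (linepath u v) (\<lambda>w. p w * smoothing_kernel L w) / (2 * pi * \<i>)
        = (\<Sum>n=1..N. a n * of_real (real n powr (- \<sigma>)) * \<phi> n * cis (- (t * ln (real n))))"
      unfolding \<phi>_def b_def by (simp add: sum_divide_distrib mult_ac)
    have "norm (F (s + 0) - p 0 + contour_integral (linepath u v) (\<lambda>w. p w * smoothing_kernel L w) / (2 * pi * \<i>))
        \<le> 2 * (H * (exp (L * c + c\<^sup>2 - R\<^sup>2) / R) * (2 * c))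
            + G * (exp (L * c + c\<^sup>2) / c) * (2 * R)
            + M * (exp (\<delta>\<^sup>2 - L * \<delta>) / \<delta>) * (2 * R)"
      unfolding u_def v_def
    proof (rule smoothed_cauchy_approximation[where f = "\<lambda>w. F (s + w)" and p = p and \<sigma> = \<sigma>])
      show "(\<lambda>w. F (s + w)) holomorphic_on {w. - \<sigma> < Re w}"
      proof -
        have "(F \<circ> (\<lambda>w. s + w)) holomorphic_on {w. - \<sigma> < Re w}"
          by (rule holomorphic_on_compose_gen[OF _ F])
             (auto intro!: holomorphic_intros simp: right_half_plane_def s_def)
        then show ?thesis by (simp add: o_def)
      qed
      show "p holomorphic_on {w. - \<sigma> < Re w}"
        unfolding p_eq[abs_def] by (intro holomorphic_intros)
    next
      fix w assume "- \<delta> \<le> Re w" "\<bar>Im w\<bar> \<le> R"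
      then show "norm (F (s + w) - p w) \<le> H"
        unfolding p_def using t by (intro hor) (auto simp: s_def)
    next
      fix w assume "Re w = c"
      then show "norm (F (s + w) - p w) \<le> G"
        unfolding p_def by (intro right) (auto simp: s_def)
    next
      fix w assume "Re w = - \<delta>" "\<bar>Im w\<bar> \<le> R"
      then show "norm (F (s + w)) \<le> M"
        using t by (intro left) (auto simp: s_def)
    qed (use pos in auto)
    then show ?thesis
      unfolding int by (simp add: p_def s_def)
  qed
  show ?thesis
    using bound approx by blast
qed

section \<open>Bounds for the series and its continuation\<close>

lemma hardy_H2_sum_le:
  assumes "a \<in> hardy_H2"
  shows "(\<Sum>n=1..N. (norm (a n))\<^sup>2) \<le> (\<Sum>n. (norm (a (Suc n)))\<^sup>2)"
proof -
  have "(\<Sum>n=1..N. (norm (a n))\<^sup>2) = (\<Sum>n<N. (norm (a (Suc n)))\<^sup>2)"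
    by (simp add: sum.atLeast1_atMost_eq)
  also have "\<dots> \<le> (\<Sum>n. (norm (a (Suc n)))\<^sup>2)"
    using assms by (intro sum_le_suminf) (auto simp: hardy_H2_def)
  finally show ?thesis .
qed

lemma hardy_H2_coeff_bounded:
  assumes "a \<in> hardy_H2"
  obtains K where "0 \<le> K" "\<And>n. 0 < n \<Longrightarrow> norm (a n) \<le> K"
proof
  define W where "W = (\<Sum>n. (norm (a (Suc n)))\<^sup>2)"
  show "0 \<le> sqrt W"
    using assms by (auto simp: W_def hardy_H2_def intro!: suminf_nonneg)
  show "norm (a n) \<le> sqrt W" if "0 < n" for n
  proof -
    have "(norm (a n))\<^sup>2 \<le> (\<Sum>k=1..n. (norm (a k))\<^sup>2)"
      using that by (intro member_le_sum) auto
    also have "\<dots> \<le> W" unfolding W_def by (rule hardy_H2_sum_le[OF assms])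
    finally show ?thesis by (rule real_le_rsqrt)
  qed
qed

lemma norm_dirichlet_partial_le:
  assumes "\<And>n. 0 < n \<Longrightarrow> norm (a n) \<le> K" "0 \<le> K" "0 \<le> Re z"
  shows "norm (dirichlet_partial a N z) \<le> K * real N"
proof -
  have "norm (dirichlet_partial a N z) \<le> (\<Sum>n=1..N. K)"
    unfolding dirichlet_partial_def
  proof (rule sum_norm_le)
    fix n assume n: "n \<in> {1..N}"
    then have "real n powr (- Re z) \<le> real n powr 0"
      using assms by (intro powr_mono) auto
    then have "norm (a n) * real n powr (- Re z) \<le> K * 1"
      using n assms by (intro mult_mono) auto
    then show "norm (a n * of_nat n powr (- z)) \<le> K"
      using n by (simp add: norm_mult norm_of_nat_powr_minus)
  qed
  then show ?thesis by (simp add: mult_ac)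
qed

text \<open>
  Far to the right the tail decays like a high power of \<open>N\<close>. The constant is \<open>\<Sum> 1 / n\<^sup>2\<close>: two units of the
  exponent ensure convergence and the remaining \<open>c - 2\<close> are bounded by their value at \<open>N\<close>.
\<close>

lemma norm_dirichlet_tail_le:
  assumes F: "is_continuation a 0 F"
    and a: "\<And>n. 0 < n \<Longrightarrow> norm (a n) \<le> K" "0 \<le> K"
    and "2 \<le> c" "c \<le> Re z" "0 < N"
  shows "norm (F z - dirichlet_partial a N z) \<le> K * real N powr (2 - c) * (pi\<^sup>2 / 6)"
proof -
  define q where "q n = K * real N powr (2 - c) * (1 / (real n + 1)\<^sup>2)" for n
  have q_sums: "q sums (K * real N powr (2 - c) * (pi\<^sup>2 / 6))"
    unfolding q_def using inverse_squares_sums by (intro sums_mult) (simp add: add.commute)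
  have term_le: "norm (dirichlet_term a z n) \<le> K * (real (Suc n) powr (2 - c) * (1 / (real n + 1)\<^sup>2))" for n
  proof -
    have "real (Suc n) powr (- Re z) \<le> real (Suc n) powr (2 - c + (-2))"
      using assms by (intro powr_mono) auto
    also have "\<dots> = real (Suc n) powr (2 - c) * real (Suc n) powr (-2)"
      by (rule powr_add)
    also have "real (Suc n) powr (-2) = 1 / (real n + 1)\<^sup>2"
      by (simp add: powr_minus powr_numeral divide_inverse add.commute)
    finally have "norm (a (Suc n)) * real (Suc n) powr (- Re z) \<le> K * (real (Suc n) powr (2 - c) * (1 / (real n + 1)\<^sup>2))"
      using a by (intro mult_mono) auto
    then show ?thesis
      by (simp only: dirichlet_term_def norm_mult norm_of_nat_powr_minus zero_less_Suc)
  qed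
  have "summable (\<lambda>n. norm (dirichlet_term a z n))"
  proof (rule summable_comparison_test')
    show "summable (\<lambda>n. K * (1 / (real n + 1)\<^sup>2))"
      using inverse_squares_sums by (intro summable_mult) (auto simp: sums_iff add.commute)
    show "norm (norm (dirichlet_term a z n)) \<le> K * (1 / (real n + 1)\<^sup>2)" for n
    proof -
      have "real (Suc n) powr (2 - c) \<le> real (Suc n) powr 0"
        using assms by (intro powr_mono) auto
      then have "K * (real (Suc n) powr (2 - c) * (1 / (real n + 1)\<^sup>2)) \<le> K * (1 * (1 / (real n + 1)\<^sup>2))"
        using a by (intro mult_left_mono mult_right_mono) auto
      then show ?thesis using term_le[of n] by simp
    qed
  qed
  then have summable: "summable (dirichlet_term a z)" by (rule summable_norm_cancel)
  moreover have "z \<in> right_half_plane 0" using assms by (simp add: right_half_plane_def)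
  ultimately have "F z = suminf (dirichlet_term a z)"
    using F by (simp add: is_continuation_def)
  then have "F z - dirichlet_partial a N z = (\<Sum>n. dirichlet_term a z (n + N))"
    unfolding dirichlet_partial_eq_sum_terms using suminf_minus_initial_segment[OF summable] by simp
  also have "norm \<dots> \<le> suminf q"
  proof (rule norm_suminf_le)
    show "summable q" using q_sums by (simp add: sums_iff)
    fix n
    have "real (Suc (n + N)) powr (2 - c) \<le> real N powr (2 - c)"
      using assms by (intro powr_mono2') auto
    moreover have "1 / (real (n + N) + 1)\<^sup>2 \<le> 1 / (real n + 1)\<^sup>2"
      by (intro divide_left_mono power_mono) auto
    ultimately have "K * (real (Suc (n + N)) powr (2 - c) * (1 / (real (n + N) + 1)\<^sup>2))
        \<le> K * (real N powr (2 - c) * (1 / (real n + 1)\<^sup>2))"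
      using a by (intro mult_left_mono mult_mono) auto
    then show "norm (dirichlet_term a z (n + N)) \<le> q n"
      using term_le[of "n + N"] unfolding q_def by (simp only: mult.assoc)
  qed
  also have "suminf q = K * real N powr (2 - c) * (pi\<^sup>2 / 6)"
    using q_sums by (simp add: sums_iff)
  finally show ?thesis .
qed

text \<open>
  The \<open>Limsup\<close> gives the bound for large \<open>\<bar>t\<bar>\<close>, at the cost of enlarging the exponent, and continuity
  gives it on the remaining compact interval.
\<close>

lemma lindelof_order_imp_bound:
  assumes "lindelof_order F \<sigma> \<le> ereal \<beta>" "\<beta> < \<gamma>" "0 < \<gamma>"
    and cont: "continuous_on UNIV (\<lambda>t. F (Complex \<sigma> t))"
  obtains C where "0 \<le> C" "\<And>t. norm (F (Complex \<sigma> t)) \<le> C * (1 + \<bar>t\<bar>) powr \<gamma>"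
proof -
  have "eventually (\<lambda>t::real. log_extended (norm (F (Complex \<sigma> t))) / ereal (ln \<bar>t\<bar>) < ereal \<gamma>) at_infinity"
    using assms unfolding lindelof_order_def by (intro Limsup_lessD) (auto intro: le_less_trans)
  then obtain b where b: "\<And>t::real. b \<le> \<bar>t\<bar> \<Longrightarrow> log_extended (norm (F (Complex \<sigma> t))) / ereal (ln \<bar>t\<bar>) < ereal \<gamma>"
    by (auto simp: eventually_at_infinity)
  define b' where "b' = max b 2"
  have large: "norm (F (Complex \<sigma> t)) \<le> 1 * (1 + \<bar>t\<bar>) powr \<gamma>" if "b' \<le> \<bar>t\<bar>" for t
  proof (cases "F (Complex \<sigma> t) = 0")
    case False
    have t: "b \<le> \<bar>t\<bar>" "2 \<le> \<bar>t\<bar>" using that by (auto simp: b'_def)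
    then have "ln (norm (F (Complex \<sigma> t))) / ln \<bar>t\<bar> < \<gamma>"
      using b[OF t(1)] False by (simp add: log_extended_def)
    moreover have "0 < ln \<bar>t\<bar>" using t by simp
    ultimately have "ln (norm (F (Complex \<sigma> t))) \<le> \<gamma> * ln \<bar>t\<bar>"
      by (simp add: field_simps)
    then have "norm (F (Complex \<sigma> t)) \<le> exp (\<gamma> * ln \<bar>t\<bar>)"
      using False by (metis exp_le_cancel_iff exp_ln zero_less_norm_iff)
    also have "\<dots> = \<bar>t\<bar> powr \<gamma>" using t by (simp add: powr_def)
    also have "\<dots> \<le> (1 + \<bar>t\<bar>) powr \<gamma>" using assms by (intro powr_mono2) auto
    finally show ?thesis by simp
  qed simp
  have "compact ((\<lambda>t. F (Complex \<sigma> t)) ` {-b'..b'})"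
    by (intro compact_continuous_image continuous_on_subset[OF cont]) auto
  then obtain C where C: "0 < C" "\<And>t. t \<in> {-b'..b'} \<Longrightarrow> norm (F (Complex \<sigma> t)) \<le> C"
    using compact_imp_bounded bounded_pos by (metis imageI)
  show thesis
  proof
    show "0 \<le> C + 1" using C by simp
    fix t
    show "norm (F (Complex \<sigma> t)) \<le> (C + 1) * (1 + \<bar>t\<bar>) powr \<gamma>"
    proof (cases "b' \<le> \<bar>t\<bar>")
      case True
      have "1 * (1 + \<bar>t\<bar>) powr \<gamma> \<le> (C + 1) * (1 + \<bar>t\<bar>) powr \<gamma>"
        using C by (intro mult_right_mono) auto
      then show ?thesis using large[OF True] by simp
    next
      case False
      then have "norm (F (Complex \<sigma> t)) \<le> C" by (intro C) auto
      also have "\<dots> \<le> (C + 1) * 1" by simp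
      also have "\<dots> \<le> (C + 1) * (1 + \<bar>t\<bar>) powr \<gamma>"
        using C assms by (intro mult_left_mono ge_one_powr_ge_zero) auto
      finally show ?thesis .
    qed
  qed
qed

section \<open>Mean square of the difference and choice of exponents\<close>

text \<open>
  Mean squares behave like squared norms, so functions at distance tending to 0 have the same limit. The
  comparison functions \<open>p T\<close> may vary with \<open>T\<close>: they will be partial sums whose length grows with \<open>T\<close>.
\<close>

lemma mean_square_perturbation:
  fixes p :: "real \<Rightarrow> real \<Rightarrow> complex" and h :: "real \<Rightarrow> complex"
  assumes cont: "\<And>T. continuous_on UNIV (p T)" "continuous_on UNIV h"
    and p: "((\<lambda>T. 1 / (2 * T) * integral {-T..T} (\<lambda>t. (norm (p T t))\<^sup>2)) \<longlongrightarrow> S) at_top"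
    and h: "((\<lambda>T. 1 / (2 * T) * integral {-T..T} (\<lambda>t. (norm (h t - p T t))\<^sup>2)) \<longlongrightarrow> 0) at_top"
  shows "((\<lambda>T. 1 / (2 * T) * integral {-T..T} (\<lambda>t. (norm (h t))\<^sup>2)) \<longlongrightarrow> S) at_top"
proof -
  define P where "P T = 1 / (2 * T) * integral {-T..T} (\<lambda>t. (norm (p T t))\<^sup>2)" for T
  define A where "A T = 1 / (2 * T) * integral {-T..T} (\<lambda>t. (norm (h t))\<^sup>2)" for T
  define D where "D T = 1 / (2 * T) * integral {-T..T} (\<lambda>t. (norm (h t - p T t))\<^sup>2)" for T
  have int: "(\<lambda>t. (norm (f t))\<^sup>2) integrable_on {-T..T}" if "continuous_on UNIV f" for f :: "real \<Rightarrow> complex" and T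
    by (intro integrable_continuous_interval continuous_intros continuous_on_subset[OF that]) auto
  have contd: "continuous_on UNIV (\<lambda>t. h t - p T t)" for T by (intro continuous_intros cont)
  have bound: "\<bar>A T - P T\<bar> \<le> D T + sqrt (D T) + (sqrt (D T) + 1 / T) * P T" if "0 < T" for T
  proof -
    \<comment> \<open>The weight in \<open>2 x y \<le> x\<^sup>2 / \<eta> + \<eta> y\<^sup>2\<close>. It tends to 0, it dominates \<open>sqrt (D T)\<close> so that
      \<open>D T / \<eta>\<close> tends to 0 too, and the summand \<open>1 / T\<close> keeps it positive.\<close>
    define \<eta> where "\<eta> = sqrt (D T) + 1 / T"
    have D0: "0 \<le> D T" unfolding D_def using that by (intro mult_nonneg_nonneg integral_nonneg int contd) auto
    then have \<eta>: "0 < \<eta>" "sqrt (D T) \<le> \<eta>" using that by (auto simp: \<eta>_def add_nonneg_pos)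
    have pointwise: "\<bar>(norm y)\<^sup>2 - (norm x)\<^sup>2\<bar> \<le> (1 + 1 / \<eta>) * (norm (y - x))\<^sup>2 + \<eta> * (norm x)\<^sup>2" for x y :: complex
    proof -
      define u where "u = norm (y - x)"
      have tri: "\<bar>norm y - norm x\<bar> \<le> u" unfolding u_def by (rule norm_triangle_ineq3)
      have "\<bar>(norm y)\<^sup>2 - (norm x)\<^sup>2\<bar> = \<bar>norm y - norm x\<bar> * (norm y + norm x)"
        by (simp add: power2_eq_square square_diff_square_factored abs_mult mult.commute)
      also have "\<dots> \<le> u * (u + 2 * norm x)"
        using tri by (intro mult_mono) auto
      also have "\<dots> = u\<^sup>2 + 2 * (u / sqrt \<eta>) * (sqrt \<eta> * norm x)"
        using \<eta> by (simp add: power2_eq_square algebra_simps)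
      also have "\<dots> \<le> u\<^sup>2 + ((u / sqrt \<eta>)\<^sup>2 + (sqrt \<eta> * norm x)\<^sup>2)"
        by (intro add_left_mono sum_squares_bound)
      also have "\<dots> = (1 + 1 / \<eta>) * u\<^sup>2 + \<eta> * (norm x)\<^sup>2"
        using \<eta> by (simp add: power_divide power_mult_distrib algebra_simps)
      finally show ?thesis by (simp add: u_def)
    qed
    have "\<bar>integral {-T..T} (\<lambda>t. (norm (h t))\<^sup>2) - integral {-T..T} (\<lambda>t. (norm (p T t))\<^sup>2)\<bar>
        = norm (integral {-T..T} (\<lambda>t. (norm (h t))\<^sup>2 - (norm (p T t))\<^sup>2))"
      by (simp add: integral_diff int cont)
    also have "\<dots> \<le> integral {-T..T} (\<lambda>t. (1 + 1 / \<eta>) * (norm (h t - p T t))\<^sup>2 + \<eta> * (norm (p T t))\<^sup>2)"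
      by (intro integral_norm_bound_integral integrable_diff integrable_add integrable_on_mult_right int cont contd)
         (use pointwise in auto)
    also have "\<dots> = (1 + 1 / \<eta>) * integral {-T..T} (\<lambda>t. (norm (h t - p T t))\<^sup>2) + \<eta> * integral {-T..T} (\<lambda>t. (norm (p T t))\<^sup>2)"
      by (subst integral_add) (auto intro!: integrable_on_mult_right int cont contd)
    finally have "1 / (2 * T) * \<bar>integral {-T..T} (\<lambda>t. (norm (h t))\<^sup>2) - integral {-T..T} (\<lambda>t. (norm (p T t))\<^sup>2)\<bar>
        \<le> 1 / (2 * T) * ((1 + 1 / \<eta>) * integral {-T..T} (\<lambda>t. (norm (h t - p T t))\<^sup>2) + \<eta> * integral {-T..T} (\<lambda>t. (norm (p T t))\<^sup>2))"
      using that by (intro mult_left_mono) auto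
    also have "\<dots> = (1 + 1 / \<eta>) * D T + \<eta> * P T"
      by (simp add: D_def P_def algebra_simps add_divide_distrib)
    also have "1 / (2 * T) * \<bar>integral {-T..T} (\<lambda>t. (norm (h t))\<^sup>2) - integral {-T..T} (\<lambda>t. (norm (p T t))\<^sup>2)\<bar> = \<bar>A T - P T\<bar>"
      using that by (simp add: A_def P_def abs_mult diff_divide_distrib[symmetric])
    finally have "\<bar>A T - P T\<bar> \<le> D T + D T / \<eta> + \<eta> * P T"
      by (simp add: algebra_simps)
    moreover have "D T / \<eta> \<le> sqrt (D T)"
    proof -
      have "D T = sqrt (D T) * sqrt (D T)" using D0 by simp
      also have "\<dots> \<le> sqrt (D T) * \<eta>" using \<eta> D0 by (intro mult_left_mono) auto
      finally show ?thesis using \<eta> by (simp add: divide_le_eq)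
    qed
    ultimately show ?thesis by (simp add: \<eta>_def)
  qed
  have "((\<lambda>T. D T + sqrt (D T) + (sqrt (D T) + 1 / T) * P T) \<longlongrightarrow> 0 + sqrt 0 + (sqrt 0 + 0) * S) at_top"
    using p h unfolding P_def[symmetric] D_def[symmetric]
    by (intro tendsto_intros tendsto_divide_0[OF tendsto_const] filterlim_at_top_imp_at_infinity filterlim_ident)
  then have "((\<lambda>T. D T + sqrt (D T) + (sqrt (D T) + 1 / T) * P T) \<longlongrightarrow> 0) at_top" by simp
  moreover have "eventually (\<lambda>T. norm (A T - P T) \<le> D T + sqrt (D T) + (sqrt (D T) + 1 / T) * P T) at_top"
    using eventually_gt_at_top[of 0] by eventually_elim (use bound in simp)
  ultimately have "((\<lambda>T. A T - P T) \<longlongrightarrow> 0) at_top"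
    by (rule Lim_null_comparison[rotated])
  from tendsto_add[OF this p[folded P_def]] show ?thesis
    by (simp add: A_def)
qed

lemma powr_times_ln_tendsto_0:
  fixes e :: real assumes "e < 0"
  shows "((\<lambda>T. T powr e * ln T) \<longlongrightarrow> 0) at_top"
  using assms by real_asymp

lemma powr_times_exp_neg_ln_square_tendsto_0:
  fixes e :: real
  shows "((\<lambda>T. T powr e * exp (- (ln T)\<^sup>2) / ln T) \<longlongrightarrow> 0) at_top"
  by real_asymp

lemma harm_le_one_plus_ln: "0 < n \<Longrightarrow> harm n \<le> 1 + ln (real n)"
  using decseqD[OF decseq_harm_diff_ln, of 0 "n - 1"] by (simp add: harm_expand)

text \<open>
  The choice of exponents: \<open>X = T powr \<xi>\<close> is the parameter of the kernel and \<open>N = T powr (\<xi> + \<theta>)\<close> the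
  length of the partial sum. The number \<open>\<xi>\<close> must satisfy \<open>\<xi> \<sigma> > \<beta>\<close>, so that the gain \<open>X powr (- \<sigma>)\<close> on
  the left edge beats the growth \<open>T powr \<beta>\<close>, and \<open>\<xi> (1 - 2 \<sigma>) < 1\<close>, so that the off-diagonal terms are
  \<open>o(T)\<close>. Such a \<open>\<xi>\<close> exists exactly if \<open>\<beta> (1 - 2 \<sigma>) < \<sigma>\<close>, which is the threshold
  \<open>\<beta> / (1 + 2 \<beta>) < \<sigma>\<close>. The truncation \<open>p\<close> of \<open>1 - 2 \<sigma>\<close> at 0 treats \<open>\<sigma> \<ge> 1 / 2\<close> at the same time.
  All conditions are open, so there is room for \<open>\<delta> < \<sigma>\<close>, \<open>\<gamma> > \<beta>\<close> and a small \<open>\<theta> > 0\<close>; the last one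
  lets the right edge be negligible once it is moved far enough, to \<open>c\<close>.
\<close>

lemma exponents_exist:
  fixes \<beta> \<sigma> :: real
  assumes "0 < \<beta>" "\<beta> / (1 + 2 * \<beta>) < \<sigma>"
  defines "p \<equiv> max 0 (1 - 2 * \<sigma>)"
  obtains \<xi> \<theta> \<delta> \<gamma> c where "0 < \<xi>" "0 < \<theta>" "0 < \<delta>" "\<delta> < \<sigma>" "\<beta> < \<gamma>" "\<gamma> < \<xi> * \<delta>"
    "(\<xi> + \<theta>) * p + 2 * \<sigma> * \<theta> < 1" "2 \<le> c" "\<delta> \<le> c" "\<xi> * c + (\<xi> + \<theta>) * (2 - c) < 0"
proof -
  have "0 < \<beta> / (1 + 2 * \<beta>)" using assms by simp
  then have \<sigma>: "0 < \<sigma>" using assms(2) by linarith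
  have p: "0 \<le> p" "p \<le> 1" using \<sigma> by (auto simp: p_def)
  have "\<beta> < \<sigma> * (1 + 2 * \<beta>)" using assms by (simp add: field_simps)
  then have "p * \<beta> < \<sigma>" using assms \<sigma> by (auto simp: p_def max_def algebra_simps)
  then have q: "0 < 1 - p * (\<beta> / \<sigma>)" using \<sigma> by (simp add: field_simps)
  \<comment> \<open>Slightly above \<open>\<beta> / \<sigma>\<close>: as \<open>p \<le> 1\<close>, this puts \<open>\<xi> * p\<close> at most halfway from
    \<open>p * (\<beta> / \<sigma>)\<close> to 1.\<close>
  define \<xi> where "\<xi> = \<beta> / \<sigma> + (1 - p * (\<beta> / \<sigma>)) / 2"
  have \<xi>: "\<beta> / \<sigma> < \<xi>" using q by (simp add: \<xi>_def)
  then have \<xi>0: "0 < \<xi>" using assms \<sigma> by (meson divide_pos_pos less_trans)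
  have "\<xi> * p = p * (\<beta> / \<sigma>) + p * ((1 - p * (\<beta> / \<sigma>)) / 2)" by (simp add: \<xi>_def algebra_simps)
  also have "\<dots> \<le> p * (\<beta> / \<sigma>) + 1 * ((1 - p * (\<beta> / \<sigma>)) / 2)"
    using p q by (intro add_left_mono mult_right_mono) auto
  also have "\<dots> < 1"
  proof -
    have "r + 1 * ((1 - r) / 2) < 1" if "0 < 1 - r" for r :: real
      using that by (simp add: field_simps)
    from this[OF q] show ?thesis .
  qed
  finally have \<xi>p: "\<xi> * p < 1" .
  define \<theta> where "\<theta> = (1 - \<xi> * p) / (2 * (p + 2 * \<sigma>))"
  have \<theta>0: "0 < \<theta>" using \<xi>p p \<sigma> by (simp add: \<theta>_def)
  have "\<theta> * (p + 2 * \<sigma>) = (1 - \<xi> * p) / 2"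
  proof -
    have "x / (2 * r) * r = x / 2" if "0 < r" for x r :: real using that by simp
    moreover have "0 < p + 2 * \<sigma>" using p \<sigma> by simp
    ultimately show ?thesis unfolding \<theta>_def by blast
  qed
  then have \<theta>: "(\<xi> + \<theta>) * p + 2 * \<sigma> * \<theta> < 1" using \<xi>p by (simp add: algebra_simps)
  have "\<beta> / \<xi> < \<sigma>" using \<xi> \<sigma> \<xi>0 by (simp add: field_simps)
  then obtain \<delta> where \<delta>: "\<beta> / \<xi> < \<delta>" "\<delta> < \<sigma>" using dense by blast
  have \<delta>0: "0 < \<delta>" using \<delta> assms \<xi>0 by (meson divide_pos_pos less_trans)
  have "\<beta> < \<xi> * \<delta>" using \<delta> \<xi>0 by (simp add: field_simps)
  then obtain \<gamma> where \<gamma>: "\<beta> < \<gamma>" "\<gamma> < \<xi> * \<delta>" using dense by blast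
  \<comment> \<open>The last condition of the lemma amounts to \<open>2 * (\<xi> + \<theta>) < \<theta> * c\<close>.\<close>
  define c where "c = 2 + \<sigma> + 2 * (\<xi> + \<theta>) / \<theta>"
  have c: "2 + \<sigma> \<le> c" using \<xi>0 \<theta>0 by (simp add: c_def)
  have "\<theta> * c = \<theta> * (2 + \<sigma>) + 2 * (\<xi> + \<theta>)" using \<theta>0 by (simp add: c_def field_simps)
  moreover have "0 < \<theta> * (2 + \<sigma>)" using \<theta>0 \<sigma> by simp
  ultimately have "\<xi> * c + (\<xi> + \<theta>) * (2 - c) < 0" by (simp add: algebra_simps)
  then show thesis
    using that[of \<xi> \<theta> \<delta> \<gamma> c] \<xi>0 \<theta>0 \<delta>0 \<delta> \<gamma> \<theta> c \<sigma> by simp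
qed

text \<open>
  The quantity that bounds the off-diagonal terms for a partial sum on the line \<open>\<sigma>\<close>. This is where
  membership in \<open>hardy_H2\<close> enters: as \<open>n powr (1 - 2 \<sigma>) \<le> N powr p\<close>, the norm can be split off.
\<close>

lemma weighted_coeff_sum_le:
  assumes "a \<in> hardy_H2" "0 \<le> p" "1 - 2 * \<sigma> \<le> p"
  shows "(\<Sum>n=1..N. real n * (norm (a n * of_real (real n powr (- \<sigma>))))\<^sup>2)
       \<le> real N powr p * (\<Sum>n. (norm (a (Suc n)))\<^sup>2)"
proof -
  have "(\<Sum>n=1..N. real n * (norm (a n * of_real (real n powr (- \<sigma>))))\<^sup>2)
      \<le> (\<Sum>n=1..N. real N powr p * (norm (a n))\<^sup>2)"
  proof (rule sum_mono)
    fix n assume n: "n \<in> {1..N}"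
    have "real n * (real n powr (- \<sigma>))\<^sup>2 = real n powr 1 * real n powr (- (2 * \<sigma>))"
      using n by (simp add: powr_power)
    also have "\<dots> = real n powr (1 - 2 * \<sigma>)"
      unfolding powr_add[symmetric] by simp
    also have "\<dots> \<le> real n powr p" using n assms by (intro powr_mono) auto
    also have "\<dots> \<le> real N powr p" using n assms by (intro powr_mono2) auto
    finally have "(real n * (real n powr (- \<sigma>))\<^sup>2) * (norm (a n))\<^sup>2 \<le> real N powr p * (norm (a n))\<^sup>2"
      by (intro mult_right_mono) auto
    then show "real n * (norm (a n * of_real (real n powr (- \<sigma>))))\<^sup>2 \<le> real N powr p * (norm (a n))\<^sup>2"
      by (simp add: norm_mult power_mult_distrib mult_ac)
  qed
  also have "\<dots> \<le> real N powr p * (\<Sum>n. (norm (a (Suc n)))\<^sup>2)"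
    unfolding sum_distrib_left[symmetric] by (intro mult_left_mono hardy_H2_sum_le assms) auto
  finally show ?thesis .
qed

lemma mean_square_dirichlet_partial:
  assumes "a \<in> hardy_H2" "0 \<le> p" "1 - 2 * \<sigma> \<le> p" "0 < T"
  shows "\<bar>1 / (2 * T) * integral {-T..T} (\<lambda>t. (norm (dirichlet_partial a N (Complex \<sigma> t)))\<^sup>2)
           - (\<Sum>n<N. (norm (a (Suc n)))\<^sup>2 * real (Suc n) powr (- 2 * \<sigma>))\<bar>
         \<le> 3 * (\<Sum>n. (norm (a (Suc n)))\<^sup>2) * (harm N * real N powr p / T)"
proof -
  define b where "b n = a n * of_real (real n powr (- \<sigma>))" for n
  define J where "J = integral {-T..T} (\<lambda>t. (norm (dirichlet_partial a N (Complex \<sigma> t)))\<^sup>2)"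
  have "\<bar>J - 2 * T * (\<Sum>n=1..N. (norm (b n))\<^sup>2)\<bar> \<le> 6 * harm N * (\<Sum>n=1..N. real n * (norm (b n))\<^sup>2)"
    unfolding J_def dirichlet_partial_vertical b_def
    using assms by (intro mean_square_dirichlet_polynomial) auto
  also have "\<dots> \<le> 6 * harm N * (real N powr p * (\<Sum>n. (norm (a (Suc n)))\<^sup>2))"
    unfolding b_def using assms by (intro mult_left_mono weighted_coeff_sum_le) (auto simp: harm_nonneg)
  finally have "1 / (2 * T) * \<bar>J - 2 * T * (\<Sum>n=1..N. (norm (b n))\<^sup>2)\<bar>
      \<le> 1 / (2 * T) * (6 * harm N * (real N powr p * (\<Sum>n. (norm (a (Suc n)))\<^sup>2)))"
    using assms by (intro mult_left_mono) auto
  also have "\<dots> = 3 * (\<Sum>n. (norm (a (Suc n)))\<^sup>2) * (harm N * real N powr p / T)"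
    using assms by simp
  also have "1 / (2 * T) * \<bar>J - 2 * T * (\<Sum>n=1..N. (norm (b n))\<^sup>2)\<bar>
      = \<bar>1 / (2 * T) * (J - 2 * T * (\<Sum>n=1..N. (norm (b n))\<^sup>2))\<bar>"
    using assms by (simp add: abs_mult)
  also have "1 / (2 * T) * (J - 2 * T * (\<Sum>n=1..N. (norm (b n))\<^sup>2)) = 1 / (2 * T) * J - (\<Sum>n=1..N. (norm (b n))\<^sup>2)"
    using assms by (simp add: field_simps)
  also have "(\<Sum>n=1..N. (norm (b n))\<^sup>2) = (\<Sum>n=1..N. (norm (a n))\<^sup>2 * real n powr (- 2 * \<sigma>))"
    by (intro sum.cong refl) (auto simp: b_def norm_mult power_mult_distrib powr_power)
  also have "\<dots> = (\<Sum>n<N. (norm (a (Suc n)))\<^sup>2 * real (Suc n) powr (- 2 * \<sigma>))"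
    by (simp add: sum.atLeast1_atMost_eq)
  finally show ?thesis unfolding J_def .
qed

text \<open>
  The mean square of \<open>F - S\<close>, where \<open>S\<close> is the partial sum: \<open>F - S\<close> is a pointwise error minus the
  Dirichlet polynomial from the left edge. The mean value inequality for that polynomial gains from
  \<open>\<delta> < \<sigma>\<close> on the diagonal, where the factor \<open>n powr \<delta>\<close> of the multiplier is absorbed by
  \<open>n powr (- \<sigma>)\<close>.
\<close>

lemma mean_square_error_le:
  fixes F :: "complex \<Rightarrow> complex" and a \<phi> :: "nat \<Rightarrow> complex"
  assumes a: "a \<in> hardy_H2" and "0 \<le> p" "1 - 2 * \<sigma> \<le> p" and T: "0 < T" and \<delta>: "0 < \<delta>" "\<delta> < \<sigma>"
    and F: "continuous_on UNIV (\<lambda>t. F (Complex \<sigma> t))"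
    and \<phi>: "\<And>n. n \<in> {1..N} \<Longrightarrow> norm (\<phi> n) \<le> real n powr \<delta> * \<Phi>"
    and E: "\<And>t. \<bar>t\<bar> \<le> T \<Longrightarrow>
       norm (F (Complex \<sigma> t) - dirichlet_partial a N (Complex \<sigma> t)
             + (\<Sum>n=1..N. a n * of_real (real n powr (- \<sigma>)) * \<phi> n * cis (- (t * ln (real n))))) \<le> E"
  shows "1 / (2 * T) * integral {-T..T} (\<lambda>t. (norm (F (Complex \<sigma> t) - dirichlet_partial a N (Complex \<sigma> t)))\<^sup>2)
       \<le> 2 * E\<^sup>2 + 2 * (\<Sum>n. (norm (a (Suc n)))\<^sup>2) * \<Phi>\<^sup>2
             * (1 + 3 * (harm N * (real N powr p * real N powr (2 * \<delta>)) / T))"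
proof -
  define W where "W = (\<Sum>n. (norm (a (Suc n)))\<^sup>2)"
  define d where "d n = a n * of_real (real n powr (- \<sigma>)) * \<phi> n" for n
  define Q where "Q t = (\<Sum>n=1..N. d n * cis (- (t * ln (real n))))" for t
  define h where "h t = F (Complex \<sigma> t) - dirichlet_partial a N (Complex \<sigma> t)" for t
  have E0: "0 \<le> E" using order_trans[OF norm_ge_zero E[of 0]] T by simp
  have cont_h: "continuous_on UNIV h"
    unfolding h_def dirichlet_partial_vertical by (intro continuous_intros F)
  have cont_Q: "continuous_on UNIV Q"
    unfolding Q_def by (intro continuous_intros)
  have int: "(\<lambda>t. (norm (f t))\<^sup>2) integrable_on {-T..T}" if "continuous_on UNIV f" for f :: "real \<Rightarrow> complex"
    by (intro integrable_continuous_interval continuous_intros continuous_on_subset[OF that]) auto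
  have d_le: "(norm (d n))\<^sup>2 \<le> \<Phi>\<^sup>2 * (real n powr (2 * \<delta>) * (norm (a n * of_real (real n powr (- \<sigma>))))\<^sup>2)"
    if "n \<in> {1..N}" for n
  proof -
    have "(norm (\<phi> n))\<^sup>2 \<le> (real n powr \<delta> * \<Phi>)\<^sup>2" by (intro power_mono \<phi> that) auto
    then have "(norm (\<phi> n))\<^sup>2 * (norm (a n * of_real (real n powr (- \<sigma>))))\<^sup>2
        \<le> (real n powr \<delta> * \<Phi>)\<^sup>2 * (norm (a n * of_real (real n powr (- \<sigma>))))\<^sup>2"
      by (intro mult_right_mono) auto
    then show ?thesis
      using that by (simp add: d_def norm_mult power_mult_distrib powr_power mult_ac)
  qed
  have diag: "(\<Sum>n=1..N. (norm (d n))\<^sup>2) \<le> \<Phi>\<^sup>2 * W"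
  proof -
    have "(\<Sum>n=1..N. (norm (d n))\<^sup>2) \<le> (\<Sum>n=1..N. \<Phi>\<^sup>2 * (norm (a n))\<^sup>2)"
    proof (rule sum_mono)
      fix n assume n: "n \<in> {1..N}"
      have "real n powr (2 * \<delta>) * (real n powr (- \<sigma>))\<^sup>2 = real n powr (2 * \<delta>) * real n powr (- (2 * \<sigma>))"
        using n by (simp add: powr_power)
      also have "\<dots> = real n powr (2 * \<delta> - 2 * \<sigma>)" unfolding powr_add[symmetric] by simp
      also have "\<dots> \<le> real n powr 0" using n \<delta> by (intro powr_mono) auto
      finally have "\<Phi>\<^sup>2 * (norm (a n))\<^sup>2 * (real n powr (2 * \<delta>) * (real n powr (- \<sigma>))\<^sup>2) \<le> \<Phi>\<^sup>2 * (norm (a n))\<^sup>2 * 1"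
        using n by (intro mult_left_mono) auto
      then show "(norm (d n))\<^sup>2 \<le> \<Phi>\<^sup>2 * (norm (a n))\<^sup>2"
        using d_le[OF n] by (simp add: norm_mult power_mult_distrib mult_ac)
    qed
    also have "\<dots> \<le> \<Phi>\<^sup>2 * W"
      unfolding sum_distrib_left[symmetric] W_def by (intro mult_left_mono hardy_H2_sum_le a) auto
    finally show ?thesis .
  qed
  have offdiag: "(\<Sum>n=1..N. real n * (norm (d n))\<^sup>2) \<le> \<Phi>\<^sup>2 * (real N powr (2 * \<delta>) * (real N powr p * W))"
  proof -
    have "(\<Sum>n=1..N. real n * (norm (d n))\<^sup>2)
        \<le> (\<Sum>n=1..N. \<Phi>\<^sup>2 * (real N powr (2 * \<delta>) * (real n * (norm (a n * of_real (real n powr (- \<sigma>))))\<^sup>2)))"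
    proof (rule sum_mono)
      fix n assume n: "n \<in> {1..N}"
      define v where "v = (norm (a n * of_real (real n powr (- \<sigma>))))\<^sup>2"
      have "real n * (norm (d n))\<^sup>2 \<le> real n * (\<Phi>\<^sup>2 * (real n powr (2 * \<delta>) * v))"
        unfolding v_def by (intro mult_left_mono d_le n) auto
      also have "\<dots> = \<Phi>\<^sup>2 * (real n powr (2 * \<delta>) * (real n * v))" by (simp add: mult_ac)
      also have "\<dots> \<le> \<Phi>\<^sup>2 * (real N powr (2 * \<delta>) * (real n * v))"
        using n \<delta> by (intro mult_left_mono mult_right_mono powr_mono2) (auto simp: v_def)
      finally show "real n * (norm (d n))\<^sup>2
          \<le> \<Phi>\<^sup>2 * (real N powr (2 * \<delta>) * (real n * (norm (a n * of_real (real n powr (- \<sigma>))))\<^sup>2))"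
        unfolding v_def .
    qed
    also have "\<dots> \<le> \<Phi>\<^sup>2 * (real N powr (2 * \<delta>) * (real N powr p * W))"
      unfolding sum_distrib_left[symmetric] W_def
      using assms by (intro mult_left_mono weighted_coeff_sum_le) auto
    finally show ?thesis .
  qed
  have "integral {-T..T} (\<lambda>t. (norm (Q t))\<^sup>2)
      \<le> 2 * T * (\<Sum>n=1..N. (norm (d n))\<^sup>2) + 6 * harm N * (\<Sum>n=1..N. real n * (norm (d n))\<^sup>2)"
    using mean_square_dirichlet_polynomial[of T d N] T unfolding Q_def by linarith
  also have "\<dots> \<le> 2 * T * (\<Phi>\<^sup>2 * W) + 6 * harm N * (\<Phi>\<^sup>2 * (real N powr (2 * \<delta>) * (real N powr p * W)))"
    using T by (intro add_mono mult_left_mono diag offdiag) (auto simp: harm_nonneg)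
  finally have Q: "integral {-T..T} (\<lambda>t. (norm (Q t))\<^sup>2)
      \<le> 2 * T * (\<Phi>\<^sup>2 * W) + 6 * harm N * (\<Phi>\<^sup>2 * (real N powr (2 * \<delta>) * (real N powr p * W)))" .
  have pointwise: "(norm (h t))\<^sup>2 \<le> 2 * E\<^sup>2 + 2 * (norm (Q t))\<^sup>2" if "\<bar>t\<bar> \<le> T" for t
  proof -
    have "norm (h t) \<le> norm (h t + Q t) + norm (Q t)"
      using norm_triangle_ineq4[of "h t + Q t" "Q t"] by simp
    also have "\<dots> \<le> E + norm (Q t)"
      using E[OF that] unfolding h_def Q_def d_def by simp
    finally have "(norm (h t))\<^sup>2 \<le> (E + norm (Q t))\<^sup>2" by (intro power_mono) auto
    also have "\<dots> \<le> 2 * E\<^sup>2 + 2 * (norm (Q t))\<^sup>2"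
      using sum_squares_bound[of E "norm (Q t)"] by (simp add: power2_sum)
    finally show ?thesis .
  qed
  have "integral {-T..T} (\<lambda>t. (norm (h t))\<^sup>2) \<le> integral {-T..T} (\<lambda>t. 2 * E\<^sup>2 + 2 * (norm (Q t))\<^sup>2)"
    using pointwise by (intro integral_le int cont_h integrable_add integrable_on_mult_right cont_Q) auto
  also have "\<dots> = 2 * T * (2 * E\<^sup>2) + 2 * integral {-T..T} (\<lambda>t. (norm (Q t))\<^sup>2)"
    using T by (subst integral_add) (auto intro!: integrable_on_mult_right int cont_Q)
  also have "\<dots> \<le> 2 * T * (2 * E\<^sup>2)
      + 2 * (2 * T * (\<Phi>\<^sup>2 * W) + 6 * harm N * (\<Phi>\<^sup>2 * (real N powr (2 * \<delta>) * (real N powr p * W))))"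
    using Q by simp
  finally have "1 / (2 * T) * integral {-T..T} (\<lambda>t. (norm (h t))\<^sup>2) \<le> 1 / (2 * T) * (2 * T * (2 * E\<^sup>2)
      + 2 * (2 * T * (\<Phi>\<^sup>2 * W) + 6 * harm N * (\<Phi>\<^sup>2 * (real N powr (2 * \<delta>) * (real N powr p * W)))))"
    using T by (intro mult_left_mono) auto
  also have "\<dots> = 2 * E\<^sup>2 + 2 * W * \<Phi>\<^sup>2 * (1 + 3 * (harm N * (real N powr p * real N powr (2 * \<delta>)) / T))"
    using T by (simp add: field_simps)
  finally show ?thesis unfolding h_def W_def .
qed

section \<open>The mean value formula\<close>

text \<open>
  All ingredients are now evaluated as \<open>T\<close> tends to infinity, with rectangles of half-height \<open>ln T\<close>: this
  costs only a logarithm on the vertical edges, and \<open>exp (- (ln T)\<^sup>2)\<close> still beats every power of \<open>T\<close> on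
  the horizontal ones.
\<close>

lemma mean_value_formula_right_of_threshold:
  assumes \<beta>: "0 < \<beta>" "\<beta> / (1 + 2 * \<beta>) < \<sigma>"
    and a: "a \<in> hardy_H2"
    and F: "is_continuation a 0 F" "finite_order 0 F"
    and mu: "\<And>\<tau>. 0 < \<tau> \<Longrightarrow> lindelof_order F \<tau> \<le> ereal \<beta>"
  shows "mean_value_formula a F \<sigma>"
proof -
  have hol: "F holomorphic_on right_half_plane 0" using F by (simp add: is_continuation_def)
  have cont_line: "continuous_on UNIV (\<lambda>t. F (Complex \<tau> t))" if "0 < \<tau>" for \<tau>
  proof (rule continuous_on_compose2[OF holomorphic_on_imp_continuous_on[OF hol]])
    show "continuous_on UNIV (Complex \<tau>)"
      unfolding complex_eq[abs_def] by (intro continuous_intros)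
  qed (use that in \<open>auto simp: right_half_plane_def\<close>)
  define p where "p = max 0 (1 - 2 * \<sigma>)"
  have p: "0 \<le> p" "1 - 2 * \<sigma> \<le> p" by (auto simp: p_def)
  obtain \<xi> \<theta> \<delta> \<gamma> c where par: "0 < \<xi>" "0 < \<theta>" "0 < \<delta>" "\<delta> < \<sigma>" "\<beta> < \<gamma>" "\<gamma> < \<xi> * \<delta>"
    "(\<xi> + \<theta>) * p + 2 * \<sigma> * \<theta> < 1" "2 \<le> c" "\<delta> \<le> c" "\<xi> * c + (\<xi> + \<theta>) * (2 - c) < 0"
    using exponents_exist[OF \<beta>] unfolding p_def by blast
  define \<kappa> where "\<kappa> = \<xi> + \<theta>"
  have \<kappa>: "0 < \<kappa>" using par by (simp add: \<kappa>_def)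
  define W where "W = (\<Sum>n. (norm (a (Suc n)))\<^sup>2)"
  have W: "0 \<le> W" using a by (auto simp: W_def hardy_H2_def intro!: suminf_nonneg)
  obtain K where K: "0 \<le> K" "\<And>n. 0 < n \<Longrightarrow> norm (a n) \<le> K"
    using hardy_H2_coeff_bounded[OF a] by blast
  obtain A0 B0 where AB0: "\<And>x t. \<sigma> - \<delta> \<le> x \<Longrightarrow> norm (F (Complex x t)) \<le> B0 * (1 + \<bar>t\<bar>) powr A0"
    using F(2) par unfolding finite_order_def by (metis add_0 diff_gt_0_iff_gt)
  \<comment> \<open>Nonnegative constants make the bound monotone in \<open>\<bar>t\<bar>\<close>.\<close>
  define A where "A = max A0 0"
  define B where "B = max B0 0"
  have AB: "0 \<le> A" "0 \<le> B" by (auto simp: A_def B_def)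
  have F_le: "norm (F z) \<le> B * (1 + \<bar>Im z\<bar>) powr A" if "\<sigma> - \<delta> \<le> Re z" for z
  proof -
    have "norm (F z) \<le> B0 * (1 + \<bar>Im z\<bar>) powr A0" using AB0[of "Re z" "Im z"] that by simp
    also have "\<dots> \<le> B * (1 + \<bar>Im z\<bar>) powr A"
      by (intro mult_mono powr_mono) (auto simp: A_def B_def)
    finally show ?thesis .
  qed
  have "0 < \<gamma>" using \<beta> par by linarith
  then obtain C where C: "0 \<le> C" "\<And>t. norm (F (Complex (\<sigma> - \<delta>) t)) \<le> C * (1 + \<bar>t\<bar>) powr \<gamma>"
    using lindelof_order_imp_bound[OF mu, of "\<sigma> - \<delta>" \<gamma>] cont_line[of "\<sigma> - \<delta>"] par by auto

  \<comment> \<open>\<open>E T\<close> bounds the pointwise error, \<open>\<Phi> T\<close> the multipliers of the left edge apart from \<open>n powr \<delta>\<close>, and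
    \<open>V q T\<close> the off-diagonal factor \<open>harm N * N powr q / T\<close>.\<close>
  define N where "N T = nat \<lceil>T powr \<kappa>\<rceil>" for T
  define E where "E T = 2 * ((B * (3 * T) powr A + K * (2 * T powr \<kappa>)) * (exp (\<xi> * ln T * c + c\<^sup>2 - (ln T)\<^sup>2) / ln T) * (2 * c))
            + K * (T powr \<kappa>) powr (2 - c) * (pi\<^sup>2 / 6) * (exp (\<xi> * ln T * c + c\<^sup>2) / c) * (2 * ln T)
            + C * (3 * T) powr \<gamma> * (exp (\<delta>\<^sup>2 - \<xi> * ln T * \<delta>) / \<delta>) * (2 * ln T)" for T
  define \<Phi> where "\<Phi> T = exp (\<delta>\<^sup>2 - \<xi> * ln T * \<delta>) / \<delta> * (2 * ln T)" for T
  define V where "V q T = 2 powr q * ((2 + \<kappa> * ln T) * T powr (\<kappa> * q) / T)" for q T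
  define b where "b n = (norm (a (Suc n)))\<^sup>2 * real (Suc n) powr (- 2 * \<sigma>)" for n
  define S where "S T t = dirichlet_partial a (N T) (Complex \<sigma> t)" for T t

  have N_bounds: "0 < N T" "T powr \<kappa> \<le> real (N T)" "real (N T) \<le> 2 * T powr \<kappa>" if "1 \<le> T" for T
  proof -
    have one: "1 \<le> T powr \<kappa>" using that \<kappa> by (simp add: ge_one_powr_ge_zero)
    then show "T powr \<kappa> \<le> real (N T)" unfolding N_def by linarith
    with one show "0 < N T" by (cases "N T") auto
    show "real (N T) \<le> 2 * T powr \<kappa>" using one unfolding N_def by linarith
  qed
  have harm_N: "harm (N T) \<le> 2 + \<kappa> * ln T" if "1 \<le> T" for T
  proof -
    have "ln (real (N T)) \<le> ln (2 * T powr \<kappa>)"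
      using N_bounds[OF that] that by (subst ln_le_cancel_iff) auto
    also have "\<dots> = ln 2 + \<kappa> * ln T" using that by (simp add: ln_mult ln_powr)
    also have "ln (2::real) \<le> 1" using ln_2_less_1 by simp
    finally show ?thesis using harm_le_one_plus_ln[OF N_bounds(1)[OF that]] by simp
  qed
  have V_ge: "harm (N T) * real (N T) powr q / T \<le> V q T" if "1 \<le> T" "0 \<le> q" for q T
  proof -
    have "real (N T) powr q \<le> (2 * T powr \<kappa>) powr q"
      using N_bounds[OF that(1)] that by (intro powr_mono2) auto
    also have "\<dots> = 2 powr q * T powr (\<kappa> * q)"
      using that by (simp add: powr_mult powr_powr)
    finally have "harm (N T) * real (N T) powr q \<le> (2 + \<kappa> * ln T) * (2 powr q * T powr (\<kappa> * q))"
      using harm_N[OF that(1)] that \<kappa> by (intro mult_mono) auto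
    then have "harm (N T) * real (N T) powr q / T \<le> (2 + \<kappa> * ln T) * (2 powr q * T powr (\<kappa> * q)) / T"
      using that by (intro divide_right_mono) auto
    then show ?thesis by (simp add: V_def mult_ac)
  qed

  have \<kappa>p: "\<kappa> * p < 1" "\<kappa> * p + 2 * \<theta> * \<delta> < 1"
  proof -
    have "2 * \<theta> * \<delta> \<le> 2 * \<theta> * \<sigma>" "0 < 2 * \<theta> * \<delta>" using par by auto
    moreover have "\<kappa> * p + 2 * \<theta> * \<sigma> < 1" using par by (simp add: \<kappa>_def mult_ac)
    ultimately show "\<kappa> * p < 1" "\<kappa> * p + 2 * \<theta> * \<delta> < 1" by linarith+
  qed
  have V_lim: "(V p \<longlongrightarrow> 0) at_top"
  proof -
    have "((\<lambda>T. 2 powr p * ((2 + \<kappa> * ln T) * T powr (\<kappa> * p) / T)) \<longlongrightarrow> 2 powr p * 0) at_top"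
      by (intro tendsto_mult tendsto_const) (use \<kappa>p in real_asymp)
    then show ?thesis by (simp add: V_def[abs_def])
  qed
  have \<Phi>_eq: "\<Phi> T = exp (\<delta>\<^sup>2) / \<delta> * 2 * (T powr (- (\<xi> * \<delta>)) * ln T)" if "1 < T" for T
    using that by (simp add: \<Phi>_def powr_def exp_diff exp_minus mult_ac divide_inverse)
  have ev1: "eventually (\<lambda>T::real. 1 < T) at_top" by (rule eventually_gt_at_top)
  have \<Phi>_lim: "(\<Phi> \<longlongrightarrow> 0) at_top"
  proof (rule Lim_transform_eventually)
    have "((\<lambda>T. exp (\<delta>\<^sup>2) / \<delta> * 2 * (T powr (- (\<xi> * \<delta>)) * ln T)) \<longlongrightarrow> exp (\<delta>\<^sup>2) / \<delta> * 2 * 0) at_top"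
      using par by (intro tendsto_mult tendsto_const powr_times_ln_tendsto_0) auto
    then show "((\<lambda>T. exp (\<delta>\<^sup>2) / \<delta> * 2 * (T powr (- (\<xi> * \<delta>)) * ln T)) \<longlongrightarrow> 0) at_top" by simp
    show "eventually (\<lambda>T. exp (\<delta>\<^sup>2) / \<delta> * 2 * (T powr (- (\<xi> * \<delta>)) * ln T) = \<Phi> T) at_top"
      using ev1 by eventually_elim (simp add: \<Phi>_eq)
  qed
  have \<Phi>V_lim: "((\<lambda>T. (\<Phi> T)\<^sup>2 * V (p + 2 * \<delta>) T) \<longlongrightarrow> 0) at_top"
  proof (rule Lim_transform_eventually)
    \<comment> \<open>The multipliers gain \<open>X powr (-2 * \<delta>)\<close> and lose \<open>N powr (2 * \<delta>)\<close>; what is left of the quotient is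
      \<open>T powr (2 * \<theta> * \<delta>)\<close>.\<close>
    define e where "e = \<kappa> * p + 2 * \<theta> * \<delta> - 1"
    define k where "k = (exp (\<delta>\<^sup>2) / \<delta> * 2)\<^sup>2 * 2 powr (p + 2 * \<delta>)"
    have "e < 0" using \<kappa>p by (simp add: e_def)
    then have "((\<lambda>T. T powr e * (2 + \<kappa> * ln T) * (ln T)\<^sup>2) \<longlongrightarrow> 0) at_top" by real_asymp
    then have "((\<lambda>T. k * (T powr e * (2 + \<kappa> * ln T) * (ln T)\<^sup>2)) \<longlongrightarrow> k * 0) at_top"
      by (intro tendsto_mult tendsto_const)
    then show "((\<lambda>T. k * (T powr e * (2 + \<kappa> * ln T) * (ln T)\<^sup>2)) \<longlongrightarrow> 0) at_top" by simp
    show "eventually (\<lambda>T. k * (T powr e * (2 + \<kappa> * ln T) * (ln T)\<^sup>2) = (\<Phi> T)\<^sup>2 * V (p + 2 * \<delta>) T) at_top"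
      using ev1
    proof eventually_elim
      fix T :: real assume T: "1 < T"
      have "e = (- (\<xi> * \<delta>)) + (- (\<xi> * \<delta>)) + \<kappa> * (p + 2 * \<delta>) - 1"
        by (simp add: e_def \<kappa>_def algebra_simps)
      then have "T powr e = T powr (- (\<xi> * \<delta>)) * T powr (- (\<xi> * \<delta>)) * T powr (\<kappa> * (p + 2 * \<delta>)) / T"
        using T by (simp only: powr_add powr_diff) simp
      then show "k * (T powr e * (2 + \<kappa> * ln T) * (ln T)\<^sup>2) = (\<Phi> T)\<^sup>2 * V (p + 2 * \<delta>) T"
        by (simp add: \<Phi>_eq[OF T] V_def k_def power2_eq_square mult_ac)
    qed
  qed
  have E_lim: "(E \<longlongrightarrow> 0) at_top"
  proof (rule Lim_transform_eventually)
    define k1 where "k1 = 4 * c * exp (c\<^sup>2) * B * 3 powr A"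
    define k2 where "k2 = 8 * c * exp (c\<^sup>2) * K"
    define k3 where "k3 = K * (pi\<^sup>2 / 6) * (exp (c\<^sup>2) / c) * 2"
    define k4 where "k4 = C * 3 powr \<gamma> * (exp (\<delta>\<^sup>2) / \<delta>) * 2"
    define Z where "Z T = k1 * (T powr (A + \<xi> * c) * exp (- (ln T)\<^sup>2) / ln T)
        + k2 * (T powr (\<kappa> + \<xi> * c) * exp (- (ln T)\<^sup>2) / ln T)
        + k3 * (T powr (\<xi> * c + \<kappa> * (2 - c)) * ln T)
        + k4 * (T powr (\<gamma> - \<xi> * \<delta>) * ln T)" for T
    have "(Z \<longlongrightarrow> k1 * 0 + k2 * 0 + k3 * 0 + k4 * 0) at_top"
      unfolding Z_def[abs_def] using par
      by (intro tendsto_add tendsto_mult tendsto_const powr_times_ln_tendsto_0 powr_times_exp_neg_ln_square_tendsto_0)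
         (auto simp: \<kappa>_def)
    then show "(Z \<longlongrightarrow> 0) at_top" by simp
    show "eventually (\<lambda>T. Z T = E T) at_top"
      using ev1
    proof eventually_elim
      fix T :: real assume T: "1 < T"
      have 1: "exp (\<xi> * ln T * c + c\<^sup>2) = T powr (\<xi> * c) * exp (c\<^sup>2)"
        using T by (simp add: powr_def exp_add mult_ac)
      have 2: "exp (\<xi> * ln T * c + c\<^sup>2 - (ln T)\<^sup>2) = T powr (\<xi> * c) * exp (c\<^sup>2) * exp (- (ln T)\<^sup>2)"
        unfolding 1[symmetric] exp_add[symmetric] by simp
      have 3: "exp (\<delta>\<^sup>2 - \<xi> * ln T * \<delta>) = exp (\<delta>\<^sup>2) / T powr (\<xi> * \<delta>)"
        using T by (simp add: powr_def exp_diff mult_ac)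
      have 4: "(3 * T) powr x = 3 powr x * T powr x" for x
        using T by (simp add: powr_mult)
      show "Z T = E T"
        unfolding Z_def E_def k1_def k2_def k3_def k4_def 1 2 3 4 powr_powr powr_add powr_diff[of T \<gamma>]
        by (simp add: algebra_simps add_divide_distrib)
    qed
  qed

  have S_cont: "continuous_on UNIV (S T)" for T
    unfolding S_def dirichlet_partial_vertical by (intro continuous_intros)
  have S_close: "1 / (2 * T) * integral {-T..T} (\<lambda>t. (norm (F (Complex \<sigma> t) - S T t))\<^sup>2)
      \<le> 2 * (E T)\<^sup>2 + 2 * W * (\<Phi> T)\<^sup>2 * (1 + 3 * V (p + 2 * \<delta>) T)" if T: "1 < T" for T
  proof -
    have T1: "1 \<le> T" "0 < ln T" "ln T \<le> T" using T ln_le_minus_one[of T] by auto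
    have Im_le: "(1 + \<bar>y\<bar>) powr x \<le> (3 * T) powr x" if "\<bar>y\<bar> \<le> T + ln T" "0 \<le> x" for x y
      using that T T1 by (intro powr_mono2) auto
    have "\<exists>\<phi> :: nat \<Rightarrow> complex.
      (\<forall>n\<in>{1..N T}. norm (\<phi> n) \<le> real n powr \<delta> * \<Phi> T) \<and>
      (\<forall>t. \<bar>t\<bar> \<le> T \<longrightarrow>
         norm (F (Complex \<sigma> t) - dirichlet_partial a (N T) (Complex \<sigma> t)
             + (\<Sum>n=1..N T. a n * of_real (real n powr (- \<sigma>)) * \<phi> n * cis (- (t * ln (real n))))) \<le> E T)"
      unfolding E_def \<Phi>_def
    proof (rule dirichlet_polynomial_approximation[OF hol])
      fix z assume z: "\<sigma> - \<delta> \<le> Re z" "\<bar>Im z\<bar> \<le> T + ln T"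
      have "norm (F z) \<le> B * (3 * T) powr A"
        using F_le[OF z(1)] mult_left_mono[OF Im_le[OF z(2) AB(1)] AB(2)] by simp
      moreover have "norm (dirichlet_partial a (N T) z) \<le> K * real (N T)"
        using z par K by (intro norm_dirichlet_partial_le) auto
      moreover have "K * real (N T) \<le> K * (2 * T powr \<kappa>)"
        using N_bounds[OF T1(1)] K by (intro mult_left_mono) auto
      ultimately show "norm (F z - dirichlet_partial a (N T) z) \<le> B * (3 * T) powr A + K * (2 * T powr \<kappa>)"
        using norm_triangle_ineq4[of "F z" "dirichlet_partial a (N T) z"] by linarith
    next
      fix z assume z: "Re z = \<sigma> + c"
      have "norm (F z - dirichlet_partial a (N T) z) \<le> K * real (N T) powr (2 - c) * (pi\<^sup>2 / 6)"
        using z par K N_bounds[OF T1(1)] by (intro norm_dirichlet_tail_le F) auto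
      also have "\<dots> \<le> K * (T powr \<kappa>) powr (2 - c) * (pi\<^sup>2 / 6)"
        using K par T N_bounds[OF T1(1)] by (intro mult_right_mono mult_left_mono powr_mono2') auto
      finally show "norm (F z - dirichlet_partial a (N T) z) \<le> K * (T powr \<kappa>) powr (2 - c) * (pi\<^sup>2 / 6)" .
    next
      fix z assume z: "Re z = \<sigma> - \<delta>" "\<bar>Im z\<bar> \<le> T + ln T"
      have "norm (F z) \<le> C * (1 + \<bar>Im z\<bar>) powr \<gamma>"
        using C(2)[of "Im z"] by (simp flip: z(1))
      also have "\<dots> \<le> C * (3 * T) powr \<gamma>"
        using C \<open>0 < \<gamma>\<close> by (intro mult_left_mono Im_le z) auto
      finally show "norm (F z) \<le> C * (3 * T) powr \<gamma>" .
    qed (use par T1 in auto)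
    then obtain \<phi> :: "nat \<Rightarrow> complex" where \<phi>:
      "\<And>n. n \<in> {1..N T} \<Longrightarrow> norm (\<phi> n) \<le> real n powr \<delta> * \<Phi> T"
      "\<And>t. \<bar>t\<bar> \<le> T \<Longrightarrow>
         norm (F (Complex \<sigma> t) - dirichlet_partial a (N T) (Complex \<sigma> t)
             + (\<Sum>n=1..N T. a n * of_real (real n powr (- \<sigma>)) * \<phi> n * cis (- (t * ln (real n))))) \<le> E T"
      by blast
    have "1 / (2 * T) * integral {-T..T} (\<lambda>t. (norm (F (Complex \<sigma> t) - S T t))\<^sup>2)
      \<le> 2 * (E T)\<^sup>2 + 2 * W * (\<Phi> T)\<^sup>2 * (1 + 3 * (harm (N T) * (real (N T) powr p * real (N T) powr (2 * \<delta>)) / T))"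
      unfolding S_def W_def
      by (rule mean_square_error_le[OF a p _ _ _ cont_line \<phi>]) (use par T in auto)
    also have "\<dots> \<le> 2 * (E T)\<^sup>2 + 2 * W * (\<Phi> T)\<^sup>2 * (1 + 3 * V (p + 2 * \<delta>) T)"
      using V_ge[of T "p + 2 * \<delta>"] T1 p par W
      by (intro add_left_mono mult_left_mono) (auto simp: powr_add)
    finally show ?thesis .
  qed
  have close: "((\<lambda>T. 1 / (2 * T) * integral {-T..T} (\<lambda>t. (norm (F (Complex \<sigma> t) - S T t))\<^sup>2)) \<longlongrightarrow> 0) at_top"
  proof (rule Lim_null_comparison)
    have "((\<lambda>T. 2 * (E T)\<^sup>2 + 2 * W * ((\<Phi> T)\<^sup>2 + 3 * ((\<Phi> T)\<^sup>2 * V (p + 2 * \<delta>) T)))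
        \<longlongrightarrow> 2 * 0\<^sup>2 + 2 * W * (0\<^sup>2 + 3 * 0)) at_top"
      by (intro tendsto_intros E_lim \<Phi>_lim \<Phi>V_lim)
    then show "((\<lambda>T. 2 * (E T)\<^sup>2 + 2 * W * (\<Phi> T)\<^sup>2 * (1 + 3 * V (p + 2 * \<delta>) T)) \<longlongrightarrow> 0) at_top"
      by (simp add: algebra_simps)
    show "eventually (\<lambda>T. norm (1 / (2 * T) * integral {-T..T} (\<lambda>t. (norm (F (Complex \<sigma> t) - S T t))\<^sup>2))
        \<le> 2 * (E T)\<^sup>2 + 2 * W * (\<Phi> T)\<^sup>2 * (1 + 3 * V (p + 2 * \<delta>) T)) at_top"
      using ev1
    proof eventually_elim
      fix T :: real assume T: "1 < T"
      have "0 \<le> integral {-T..T} (\<lambda>t. (norm (F (Complex \<sigma> t) - S T t))\<^sup>2)"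
        using par cont_line[of \<sigma>] S_cont[of T]
        by (intro integral_nonneg integrable_continuous_interval continuous_intros)
           (auto elim: continuous_on_subset)
      then show "norm (1 / (2 * T) * integral {-T..T} (\<lambda>t. (norm (F (Complex \<sigma> t) - S T t))\<^sup>2))
        \<le> 2 * (E T)\<^sup>2 + 2 * W * (\<Phi> T)\<^sup>2 * (1 + 3 * V (p + 2 * \<delta>) T)"
        using S_close[OF T] T by simp
    qed
  qed

  have summable_b: "summable b"
  proof (rule summable_comparison_test')
    show "summable (\<lambda>n. (norm (a (Suc n)))\<^sup>2)" using a by (simp add: hardy_H2_def)
    show "norm (b n) \<le> (norm (a (Suc n)))\<^sup>2" for n
    proof -
      have "real (Suc n) powr (- 2 * \<sigma>) \<le> real (Suc n) powr 0" using par by (intro powr_mono) auto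
      then have "(norm (a (Suc n)))\<^sup>2 * real (Suc n) powr (- 2 * \<sigma>) \<le> (norm (a (Suc n)))\<^sup>2 * 1"
        by (intro mult_left_mono) auto
      then show ?thesis by (simp add: b_def)
    qed
  qed
  have N_lim: "filterlim N at_top at_top"
    unfolding N_def using \<kappa> by real_asymp
  have partial: "((\<lambda>T. 1 / (2 * T) * integral {-T..T} (\<lambda>t. (norm (S T t))\<^sup>2)) \<longlongrightarrow> suminf b) at_top"
  proof -
    have sums: "((\<lambda>T. \<Sum>n<N T. b n) \<longlongrightarrow> suminf b) at_top"
      using filterlim_compose[OF summable_LIMSEQ[OF summable_b] N_lim] .
    have "((\<lambda>T. 1 / (2 * T) * integral {-T..T} (\<lambda>t. (norm (S T t))\<^sup>2) - (\<Sum>n<N T. b n)) \<longlongrightarrow> 0) at_top"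
    proof (rule Lim_null_comparison)
      show "((\<lambda>T. 3 * W * V p T) \<longlongrightarrow> 0) at_top"
        using tendsto_mult[OF tendsto_const V_lim, of "3 * W"] by simp
      show "eventually (\<lambda>T. norm (1 / (2 * T) * integral {-T..T} (\<lambda>t. (norm (S T t))\<^sup>2) - (\<Sum>n<N T. b n)) \<le> 3 * W * V p T) at_top"
        using ev1
      proof eventually_elim
        fix T :: real assume T: "1 < T"
        have "norm (1 / (2 * T) * integral {-T..T} (\<lambda>t. (norm (S T t))\<^sup>2) - (\<Sum>n<N T. b n))
            \<le> 3 * W * (harm (N T) * real (N T) powr p / T)"
          unfolding real_norm_def S_def b_def W_def
          using T p by (intro mean_square_dirichlet_partial a) auto
        also have "\<dots> \<le> 3 * W * V p T"
          using T p W by (intro mult_left_mono V_ge) auto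
        finally show "norm (1 / (2 * T) * integral {-T..T} (\<lambda>t. (norm (S T t))\<^sup>2) - (\<Sum>n<N T. b n)) \<le> 3 * W * V p T" .
      qed
    qed
    from tendsto_add[OF this sums] show ?thesis by simp
  qed
  have "((\<lambda>T. 1 / (2 * T) * integral {-T..T} (\<lambda>t. (norm (F (Complex \<sigma> t)))\<^sup>2)) \<longlongrightarrow> suminf b) at_top"
    using par by (intro mean_square_perturbation[OF S_cont cont_line partial close]) auto
  then show ?thesis
    using summable_b by (simp add: mean_value_formula_def b_def[abs_def])
qed

theorem theorem1:
  fixes \<beta> :: real and a :: "nat \<Rightarrow> complex" and F :: "complex \<Rightarrow> complex"
  assumes "\<beta> > 0"
    and "a \<in> hardy_H2"
    and "is_continuation a 0 F"
    and "finite_order 0 F"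
    and "\<forall>\<sigma>>0. lindelof_order F \<sigma> \<le> ereal \<beta>"
  shows "sigma_m a \<le> ereal (\<beta> / (1 + 2 * \<beta>))"
proof -
  define \<kappa> where "\<kappa> = \<beta> / (1 + 2 * \<beta>)"
  have \<kappa>: "0 < \<kappa>" using assms(1) by (simp add: \<kappa>_def)
  have sub: "right_half_plane \<kappa> \<subseteq> right_half_plane 0" using \<kappa> by (auto simp: right_half_plane_def)
  have "is_continuation a \<kappa> F"
    using assms(3) sub unfolding is_continuation_def by (auto intro: holomorphic_on_subset)
  moreover have "finite_order \<kappa> F"
    unfolding finite_order_def
  proof (intro allI impI)
    fix \<epsilon> :: real assume "0 < \<epsilon>"
    then obtain A B where "\<forall>\<sigma> t. 0 + \<epsilon> \<le> \<sigma> \<longrightarrow> norm (F (Complex \<sigma> t)) \<le> B * (1 + \<bar>t\<bar>) powr A"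
      using assms(4) unfolding finite_order_def by blast
    then show "\<exists>A B. \<forall>\<sigma> t. \<kappa> + \<epsilon> \<le> \<sigma> \<longrightarrow> norm (F (Complex \<sigma> t)) \<le> B * (1 + \<bar>t\<bar>) powr A"
      using \<kappa> by (intro exI[of _ A] exI[of _ B]) auto
  qed
  moreover have "\<forall>\<sigma>>\<kappa>. mean_value_formula a F \<sigma>"
    using assms unfolding \<kappa>_def by (blast intro: mean_value_formula_right_of_threshold)
  ultimately have "ereal \<kappa> \<in> {ereal \<kappa> | \<kappa>. \<exists>F. is_continuation a \<kappa> F \<and> finite_order \<kappa> F \<and>
                                  (\<forall>\<sigma>>\<kappa>. mean_value_formula a F \<sigma>)}"
    by blast
  then show ?thesis
    unfolding sigma_m_def \<kappa>_def[symmetric] by (rule Inf_lower)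
qed

end
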